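(* Let $k\ge1$, let $B=G_k|z\rangle$ be a Pauli X-orbit of $G_k=\langle\overline X_1,\dots,\overline X_k\rangle$ on $n$ qubits, so that $\dim\operatorname{span}(B)=2^k$, and let $P_B=\sum_{|w\rangle\in B}|w\rangle\langle w|$ be the projector onto $\operatorname{span}(B)$. 1. There exists a permutation operator $M$ consisting of $\mathcal O(nk)$ X and CX gates such that $$M P_B M^\dagger=I_k\otimes|0\rangle\langle0|_{n-k},$$ where $I_k$ is the identity operator on $k$ qubits and $|0\rangle\langle0|_{n-k}=\bigotimes_{i=1}^{n-k}|0\rangle\langle0|$. 2. Let $\sigma\in S_n$ be a Pauli string that commutes with $P_B$. Then there exists $\widehat\sigma\in S_k$ such that, for a suitable choice of the sign, $$\sigma P_B=\pm M^\dagger\big(\widehat\sigma\otimes|0\rangle\langle0|_{n-k}\big)M.$$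
   Context: Pauli strings: $S_n=\{i^{\mathbf a\cdot\mathbf b}X^{\mathbf a}Z^{\mathbf b}:\mathbf a,\mathbf b\in\{0,1\}^n\}$, with $X^{\mathbf a}=X^{a_1}\otimes\cdots\otimes X^{a_n}$, $Z^{\mathbf b}=Z^{b_1}\otimes\cdots\otimes Z^{b_n}$ and $\mathbf a\cdot\mathbf b=\sum_ja_jb_j\pmod 4$. Pauli X-orbit: $\overline X_1,\dots,\overline X_k\in\{I,X\}^{\otimes n}$ form a minimal generating set of the group $G_k=\langle\overline X_1,\dots,\overline X_k\rangle$, $|z\rangle$ is a computational basis state, and $G_k|z\rangle=\{g|z\rangle:g\in G_k\}$ is a set of $2^k$ computational basis states. CX gates may act between any two qubits. *)

theory Defs
  imports
    Complex_Main
    "HOL-Algebra.Generated_Groups"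
    "Jordan_Normal_Form.Matrix"
    "Jordan_Normal_Form.Schur_Decomposition"
begin

section \<open>Tensor products of matrices\<close>

text \<open>Kronecker product; the left factor carries the most significant part of the index.\<close>

definition kron :: "complex mat \<Rightarrow> complex mat \<Rightarrow> complex mat" (infixr "\<otimes>\<^sub>K" 72) where
  "A \<otimes>\<^sub>K B = mat (dim_row A * dim_row B) (dim_col A * dim_col B)
     (\<lambda>(i, j). A $$ (i div dim_row B, j div dim_col B) * B $$ (i mod dim_row B, j mod dim_col B))"

definition tensor_list :: "complex mat list \<Rightarrow> complex mat" where
  "tensor_list As = foldr kron As (1\<^sub>m 1)"

section \<open>Computational basis states\<close>

text \<open>States are column matrices, so that the outer product of \<open>v\<close> and \<open>w\<close> is
  \<open>v * mat_adjoint w\<close>. The bit \<open>False\<close> stands for 0 and \<open>True\<close> for 1.\<close>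

definition ket1 :: "bool \<Rightarrow> complex mat" where
  "ket1 b = (if b then mat_of_rows_list 1 [[0], [1]] else mat_of_rows_list 1 [[1], [0]])"

definition ket :: "bool list \<Rightarrow> complex mat" where
  "ket bs = tensor_list (map ket1 bs)"

definition proj1 :: "bool \<Rightarrow> complex mat" where
  "proj1 b = ket1 b * mat_adjoint (ket1 b)"

definition zero_proj :: "nat \<Rightarrow> complex mat" where
  "zero_proj m = tensor_list (replicate m (proj1 False))"

section \<open>Pauli strings\<close>

definition pauli_X :: "complex mat" where
  "pauli_X = mat_of_rows_list 2 [[0, 1], [1, 0]]"

definition pauli_Z :: "complex mat" where
  "pauli_Z = mat_of_rows_list 2 [[1, 0], [0, -1]]"

definition X_pow :: "bool list \<Rightarrow> complex mat" where
  "X_pow a = tensor_list (map (\<lambda>b. pauli_X ^\<^sub>m of_bool b) a)"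

definition Z_pow :: "bool list \<Rightarrow> complex mat" where
  "Z_pow b = tensor_list (map (\<lambda>b. pauli_Z ^\<^sub>m of_bool b) b)"

definition bit_dot :: "bool list \<Rightarrow> bool list \<Rightarrow> nat" where
  "bit_dot a b = (\<Sum>j<length a. of_bool (a ! j) * of_bool (b ! j)) mod 4"

definition pauli_strings :: "nat \<Rightarrow> complex mat set" where
  "pauli_strings n =
     {\<i> ^ bit_dot a b \<cdot>\<^sub>m (X_pow a * Z_pow b) | a b. length a = n \<and> length b = n}"

section \<open>Pauli X-orbits\<close>

definition IX_strings :: "nat \<Rightarrow> complex mat set" where
  "IX_strings n = {tensor_list As | As. length As = n \<and> set As \<subseteq> {1\<^sub>m 2, pauli_X}}"

text \<open>The ambient group in which the Pauli strings generate subgroups: all invertible complex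
  matrices of size \<open>2 ^ n\<close> under multiplication.\<close>

definition GL :: "nat \<Rightarrow> complex mat monoid" where
  "GL n = units_of (ring_mat TYPE(complex) (2 ^ n) ())"

definition X_group :: "nat \<Rightarrow> complex mat list \<Rightarrow> complex mat set" where
  "X_group n Xs = generate (GL n) (set Xs)"

definition minimal_X_generators :: "nat \<Rightarrow> complex mat list \<Rightarrow> bool" where
  "minimal_X_generators n Xs \<longleftrightarrow> set Xs \<subseteq> IX_strings n \<and> distinct Xs \<and>
     (\<forall>H. H \<subset> set Xs \<longrightarrow> generate (GL n) H \<noteq> X_group n Xs)"

definition X_orbit :: "nat \<Rightarrow> complex mat list \<Rightarrow> bool list \<Rightarrow> complex mat set" where
  "X_orbit n Xs z = (\<lambda>g. g * ket z) ` X_group n Xs"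

text \<open>Entrywise sum of the outer products, since matrices of unspecified dimension do not form
  an additive monoid type.\<close>

definition orbit_proj :: "nat \<Rightarrow> complex mat set \<Rightarrow> complex mat" where
  "orbit_proj n B = mat (2 ^ n) (2 ^ n) (\<lambda>(i, j). \<Sum>w\<in>B. (w * mat_adjoint w) $$ (i, j))"

section \<open>Circuits of X and CX gates\<close>

datatype gate = X_gate nat | CX_gate (control: nat) (target: nat)

fun valid_gate :: "nat \<Rightarrow> gate \<Rightarrow> bool" where
  "valid_gate n (X_gate q) \<longleftrightarrow> q < n"
| "valid_gate n (CX_gate c t) \<longleftrightarrow> c < n \<and> t < n \<and> c \<noteq> t"

fun gate_mat :: "nat \<Rightarrow> gate \<Rightarrow> complex mat" where
  "gate_mat n (X_gate q) = tensor_list (map (\<lambda>j. if j = q then pauli_X else 1\<^sub>m 2) [0..<n])"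
| "gate_mat n (CX_gate c t) =
     tensor_list (map (\<lambda>j. if j = c then proj1 False else 1\<^sub>m 2) [0..<n]) +
     tensor_list (map (\<lambda>j. if j = c then proj1 True else if j = t then pauli_X else 1\<^sub>m 2) [0..<n])"

definition circuit_mat :: "nat \<Rightarrow> gate list \<Rightarrow> complex mat" where
  "circuit_mat n gs = foldr (\<lambda>g M. gate_mat n g * M) gs (1\<^sub>m (2 ^ n))"

definition permutation_operator :: "nat \<Rightarrow> complex mat \<Rightarrow> bool" where
  "permutation_operator n M \<longleftrightarrow>
     (\<exists>p. p permutes {..<2 ^ n} \<and> M = mat (2 ^ n) (2 ^ n) (\<lambda>(i, j). if i = p j then 1 else 0))"

end

theory Submission
  imports Defs
begin

text \<open>Every matrix involved sends each basis state to a multiple of a basis state, so the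
  theorem is a statement about vectors over the field with two elements. There a Pauli X-orbit is
  a translate of a \<open>k\<close>-dimensional linear subspace, an X gate is a translation and a CX gate is an
  elementary row operation. At most \<open>n\<close> X gates move the orbit to the subspace, and Gaussian
  elimination, with at most \<open>n\<close> CX gates per generator, moves the subspace to the span of the
  first \<open>k\<close> coordinates. For the second part, circuits of X and CX gates conjugate a
  Pauli string to a Pauli string up to sign. If the original string commutes with \<open>P\<^sub>B\<close>, then the
  conjugated one preserves the span of the first \<open>k\<close> coordinates, so its X-part is trivial on the
  other qubits; its Z-part there acts as the identity on \<open>|0\<rangle>\<close>.\<close>

section \<open>Bit vectors as matrix indices\<close>

definition bvecs :: "nat \<Rightarrow> bool list set" where
  "bvecs n = {v. length v = n}"

lemma bvecs_iff [simp]: "v \<in> bvecs n \<longleftrightarrow> length v = n"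
  by (simp add: bvecs_def)

text \<open>The head of the list is the most significant bit, as in \<open>kron\<close>, whose left
  factor carries the high part of the index.\<close>

fun bvec_index :: "bool list \<Rightarrow> nat" where
  "bvec_index [] = 0"
| "bvec_index (b # bs) = of_bool b * 2 ^ length bs + bvec_index bs"

lemma bvec_index_less: "bvec_index v < 2 ^ length v"
  by (induction v) auto

lemma bvec_index_append:
  "bvec_index (u @ v) = bvec_index u * 2 ^ length v + bvec_index v"
  by (induction u) (auto simp: power_add algebra_simps)

lemma bvec_index_eq_iff:
  "length u = length v \<Longrightarrow> bvec_index u = bvec_index v \<longleftrightarrow> u = v"
proof (induction u v rule: list_induct2)
  case (Cons x xs y ys)
  then show ?case
    using bvec_index_less[of xs] bvec_index_less[of ys] by (cases x; cases y) auto
qed simp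

lemma bvec_index_surj: "i < 2 ^ n \<Longrightarrow> \<exists>v. length v = n \<and> bvec_index v = i"
proof (induction n arbitrary: i)
  case (Suc n)
  show ?case
  proof (cases "i < 2 ^ n")
    case True
    then obtain v where "length v = n" "bvec_index v = i" using Suc.IH by blast
    then show ?thesis by (intro exI[of _ "False # v"]) simp
  next
    case False
    then have "i - 2 ^ n < 2 ^ n" using Suc.prems by simp
    then obtain v where "length v = n" "bvec_index v = i - 2 ^ n" using Suc.IH by blast
    then show ?thesis using False by (intro exI[of _ "True # v"]) simp
  qed
qed simp

lemma bij_betw_bvec_index: "bij_betw bvec_index (bvecs n) {..<2 ^ n}"
proof (rule bij_betw_imageI)
  show "inj_on bvec_index (bvecs n)"
    by (rule inj_onI) (simp add: bvec_index_eq_iff)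
  show "bvec_index ` bvecs n = {..<2 ^ n}"
  proof
    show "bvec_index ` bvecs n \<subseteq> {..<2 ^ n}"
      using bvec_index_less by (auto simp: bvecs_def)
    show "{..<2 ^ n} \<subseteq> bvec_index ` bvecs n"
    proof
      fix i :: nat assume "i \<in> {..<2 ^ n}"
      then obtain v where "length v = n" "bvec_index v = i" using bvec_index_surj[of i n] by auto
      then show "i \<in> bvec_index ` bvecs n" by (intro image_eqI[of _ _ v]) auto
    qed
  qed
qed

lemma finite_bvecs [simp]: "finite (bvecs n)"
  using bij_betw_finite[OF bij_betw_bvec_index] by blast

lemma sum_bvecs: "(\<Sum>i<2 ^ n. g i) = (\<Sum>v\<in>bvecs n. g (bvec_index v))"
  using sum.reindex_bij_betw[OF bij_betw_bvec_index, of g n] by simp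

definition index_bvec :: "nat \<Rightarrow> nat \<Rightarrow> bool list" where
  "index_bvec n = inv_into (bvecs n) bvec_index"

lemma index_bvec_index [simp]: "length v = n \<Longrightarrow> index_bvec n (bvec_index v) = v"
  unfolding index_bvec_def
  by (rule inv_into_f_f) (use bij_betw_bvec_index in \<open>auto simp: bij_betw_def\<close>)

lemma eq_matI_bvec:
  assumes "A \<in> carrier_mat (2 ^ n) (2 ^ m)" "B \<in> carrier_mat (2 ^ n) (2 ^ m)"
    and "\<And>u v. length u = n \<Longrightarrow> length v = m \<Longrightarrow>
      A $$ (bvec_index u, bvec_index v) = B $$ (bvec_index u, bvec_index v)"
  shows "A = B"
proof (rule eq_matI)
  fix i j assume "i < dim_row B" "j < dim_col B"
  then show "A $$ (i, j) = B $$ (i, j)"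
    using assms bvec_index_surj[of i n] bvec_index_surj[of j m] by auto
qed (use assms in auto)

lemma index_mult_mat_bvec:
  fixes A B :: "complex mat"
  assumes "A \<in> carrier_mat (2 ^ l) (2 ^ n)" "B \<in> carrier_mat (2 ^ n) (2 ^ m)"
    and "length u = l" "length v = m"
  shows "(A * B) $$ (bvec_index u, bvec_index v) =
    (\<Sum>w\<in>bvecs n. A $$ (bvec_index u, bvec_index w) * B $$ (bvec_index w, bvec_index v))"
  using assms bvec_index_less[of u] bvec_index_less[of v]
  by (simp add: scalar_prod_def sum_bvecs flip: lessThan_atLeast0)

lemma index_mat_bvec [simp]:
  "length u = n \<Longrightarrow> length v = m \<Longrightarrow>
    mat (2 ^ n) (2 ^ m) F $$ (bvec_index u, bvec_index v) = F (bvec_index u, bvec_index v)"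
  using bvec_index_less[of u] bvec_index_less[of v] by simp

section \<open>Monomial matrices\<close>

text \<open>Column \<open>v\<close> of \<open>monomial n c f\<close> is \<open>c v \<cdot>\<^sub>m ket (f v)\<close>.\<close>

definition monomial :: "nat \<Rightarrow> (bool list \<Rightarrow> complex) \<Rightarrow> (bool list \<Rightarrow> bool list) \<Rightarrow> complex mat" where
  "monomial n c f = mat (2 ^ n) (2 ^ n) (\<lambda>(i, j).
     if i = bvec_index (f (index_bvec n j)) then c (index_bvec n j) else 0)"

lemma monomial_carrier [simp, intro]: "monomial n c f \<in> carrier_mat (2 ^ n) (2 ^ n)"
  by (simp add: monomial_def)

lemma dim_monomial [simp]: "dim_row (monomial n c f) = 2 ^ n" "dim_col (monomial n c f) = 2 ^ n"
  by (simp_all add: monomial_def)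

lemma index_monomial:
  assumes "f \<in> bvecs n \<rightarrow> bvecs n" "length u = n" "length v = n"
  shows "monomial n c f $$ (bvec_index u, bvec_index v) = (if u = f v then c v else 0)"
proof -
  have "length (f v) = n" using assms by auto
  then show ?thesis using assms by (simp add: monomial_def bvec_index_eq_iff)
qed

lemma eq_monomialI:
  assumes "A \<in> carrier_mat (2 ^ n) (2 ^ n)" "f \<in> bvecs n \<rightarrow> bvecs n"
    and "\<And>u v. length u = n \<Longrightarrow> length v = n \<Longrightarrow>
      A $$ (bvec_index u, bvec_index v) = (if u = f v then c v else 0)"
  shows "A = monomial n c f"
  using assms by (intro eq_matI_bvec[where n = n and m = n]) (auto simp: index_monomial)

text \<open>A column with zero coefficient does not see the map, so the maps have to agree only
  where the coefficient is nonzero. Products with projectors rely on this freedom.\<close>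

lemma monomial_cong:
  assumes "\<And>v. length v = n \<Longrightarrow> c v = d v" "\<And>v. length v = n \<Longrightarrow> c v \<noteq> 0 \<Longrightarrow> f v = g v"
    and "f \<in> bvecs n \<rightarrow> bvecs n" "g \<in> bvecs n \<rightarrow> bvecs n"
  shows "monomial n c f = monomial n d g"
proof (rule eq_monomialI)
  fix u v :: "bool list" assume "length u = n" "length v = n"
  then show "monomial n c f $$ (bvec_index u, bvec_index v) = (if u = g v then d v else 0)"
    using assms(1,2)[of v] assms(3) by (cases "c v = 0") (simp_all add: index_monomial)
qed (use assms in auto)

text \<open>Column \<open>v\<close> has its only possible nonzero entry in row \<open>f v\<close> on
  one side and in row \<open>g v\<close> on the other. This turns a given matrix equation, such as
  commutation, into conditions on single bit vectors.\<close>

lemma monomial_eqD: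
  assumes "monomial n c f = monomial n d g"
    and "f \<in> bvecs n \<rightarrow> bvecs n" "g \<in> bvecs n \<rightarrow> bvecs n" "length v = n"
  shows "(if f v = g v then c v = d v else c v = 0 \<and> d v = 0)"
proof -
  have "(if u = f v then c v else 0) = (if u = g v then d v else 0)" if "length u = n" for u
    using assms that by (metis index_monomial)
  moreover have "length (f v) = n" "length (g v) = n" using assms(2-4) by (auto simp: Pi_def)
  ultimately show ?thesis by metis
qed

lemma one_mat_monomial: "1\<^sub>m (2 ^ n) = monomial n (\<lambda>_. 1) (\<lambda>v. v)"
proof (rule eq_monomialI)
  fix u v :: "bool list" assume "length u = n" "length v = n"
  then show "1\<^sub>m (2 ^ n) $$ (bvec_index u, bvec_index v) = (if u = v then 1 else 0 :: complex)"
    using bvec_index_less[of u] bvec_index_less[of v] by (simp add: bvec_index_eq_iff)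
qed auto

lemma monomial_mult:
  assumes "f \<in> bvecs n \<rightarrow> bvecs n" "g \<in> bvecs n \<rightarrow> bvecs n"
  shows "monomial n c f * monomial n d g = monomial n (\<lambda>v. c (g v) * d v) (\<lambda>v. f (g v))"
proof (rule eq_monomialI)
  show "monomial n c f * monomial n d g \<in> carrier_mat (2 ^ n) (2 ^ n)"
    using mult_carrier_mat by blast
  show "(\<lambda>v. f (g v)) \<in> bvecs n \<rightarrow> bvecs n" using assms by auto
  fix u v :: "bool list" assume uv: "length u = n" "length v = n"
  then have "g v \<in> bvecs n" using assms by auto
  have "(monomial n c f * monomial n d g) $$ (bvec_index u, bvec_index v) =
      (\<Sum>w\<in>bvecs n. if w = g v then (if u = f w then c w * d v else 0) else 0)"
    using assms uv
    by (subst index_mult_mat_bvec[where l = n and m = n and n = n])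
      (auto simp: index_monomial intro!: sum.cong simp del: sum.delta sum.delta')
  also have "\<dots> = (if u = f (g v) then c (g v) * d v else 0)"
    using \<open>g v \<in> bvecs n\<close> by (simp add: sum.delta)
  finally show "(monomial n c f * monomial n d g) $$ (bvec_index u, bvec_index v) =
      (if u = f (g v) then c (g v) * d v else 0)" .
qed

lemma smult_monomial: "s \<cdot>\<^sub>m monomial n c f = monomial n (\<lambda>v. s * c v) f"
  by (rule eq_matI) (auto simp: monomial_def)

lemma dim_mat_adjoint [simp]:
  "dim_row (mat_adjoint A) = dim_col A" "dim_col (mat_adjoint A) = dim_row A"
  by (simp_all add: mat_adjoint_def)

lemma index_mat_adjoint:
  "i < dim_col A \<Longrightarrow> j < dim_row A \<Longrightarrow> mat_adjoint A $$ (i, j) = cnj (A $$ (j, i))"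
  for A :: "complex mat"
  by (simp add: mat_adjoint_def mat_of_rows_index conjugate_complex_def)

text \<open>With all coefficients 1 the adjoint is the transpose of a permutation matrix, that is,
  its inverse.\<close>

lemma mat_adjoint_monomial:
  assumes "f \<in> bvecs n \<rightarrow> bvecs n" "g \<in> bvecs n \<rightarrow> bvecs n"
    and "\<And>v. length v = n \<Longrightarrow> f (g v) = v" "\<And>v. length v = n \<Longrightarrow> g (f v) = v"
  shows "mat_adjoint (monomial n (\<lambda>_. 1) f) = monomial n (\<lambda>_. 1) g"
proof (rule eq_monomialI)
  fix u v :: "bool list" assume uv: "length u = n" "length v = n"
  have "mat_adjoint (monomial n (\<lambda>_. 1) f) $$ (bvec_index u, bvec_index v) =
      (if v = f u then 1 else 0)"
    using uv bvec_index_less[of u] bvec_index_less[of v] assms(1)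
    by (simp add: index_mat_adjoint index_monomial)
  also have "v = f u \<longleftrightarrow> u = g v" using assms uv by metis
  finally show "mat_adjoint (monomial n (\<lambda>_. 1) f) $$ (bvec_index u, bvec_index v) =
      (if u = g v then 1 else 0)" .
qed (use assms in auto)

section \<open>Kronecker and tensor products of monomial matrices\<close>

lemma monomial_kron:
  assumes "f \<in> bvecs m \<rightarrow> bvecs m" "g \<in> bvecs n \<rightarrow> bvecs n"
  shows "monomial m c f \<otimes>\<^sub>K monomial n d g =
    monomial (m + n) (\<lambda>v. c (take m v) * d (drop m v)) (\<lambda>v. f (take m v) @ g (drop m v))"
proof (rule eq_monomialI)
  show "monomial m c f \<otimes>\<^sub>K monomial n d g \<in> carrier_mat (2 ^ (m + n)) (2 ^ (m + n))"
    by (simp add: kron_def power_add)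
  show maps: "(\<lambda>v. f (take m v) @ g (drop m v)) \<in> bvecs (m + n) \<rightarrow> bvecs (m + n)"
    using assms by (fastforce simp: Pi_def)
  fix u v :: "bool list" assume uv: "length u = m + n" "length v = m + n"
  define u1 u2 v1 v2 where "u1 = take m u" "u2 = drop m u" "v1 = take m v" "v2 = drop m v"
  note uv_def = this
  have len: "length u1 = m" "length u2 = n" "length v1 = m" "length v2 = n"
    using uv by (auto simp: uv_def)
  have app: "u = u1 @ u2" "v = v1 @ v2" by (auto simp: uv_def)
  have less: "bvec_index u2 < 2 ^ n" "bvec_index v2 < 2 ^ n" "bvec_index u < 2 ^ (m + n)"
      "bvec_index v < 2 ^ (m + n)"
    using bvec_index_less len uv by metis+
  have fg: "length (f v1) = m" "length (g v2) = n" using assms len by auto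
  have "(monomial m c f \<otimes>\<^sub>K monomial n d g) $$ (bvec_index u, bvec_index v) =
      monomial m c f $$ (bvec_index u1, bvec_index v1) *
      monomial n d g $$ (bvec_index u2, bvec_index v2)"
    \<comment> \<open>Division by \<open>2 ^ n\<close> with remainder separates the index of
      \<open>u1 @ u2\<close> into those of \<open>u1\<close> and \<open>u2\<close>, because the
      index of \<open>u2\<close> is below \<open>2 ^ n\<close>.\<close>
    using less len unfolding kron_def
    by (simp add: power_add[symmetric]) (simp add: app bvec_index_append)
  also have "\<dots> = (if u1 @ u2 = f v1 @ g v2 then c v1 * d v2 else 0)"
    using assms len fg by (simp add: index_monomial append_eq_append_conv)
  finally show "(monomial m c f \<otimes>\<^sub>K monomial n d g) $$ (bvec_index u, bvec_index v) =
      (if u = f (take m v) @ g (drop m v) then c (take m v) * d (drop m v) else 0)"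
    by (simp add: app len)
qed

lemma tensor_list_carrier:
  assumes "\<And>A. A \<in> set As \<Longrightarrow> A \<in> carrier_mat 2 2"
  shows "tensor_list As \<in> carrier_mat (2 ^ length As) (2 ^ length As)"
  using assms
proof (induction As)
  case (Cons A As)
  then have "A \<in> carrier_mat 2 2" "tensor_list As \<in> carrier_mat (2 ^ length As) (2 ^ length As)"
    by auto
  then show ?case by (simp add: tensor_list_def kron_def)
qed (simp add: tensor_list_def)

lemma index_tensor_list:
  assumes "\<And>A. A \<in> set As \<Longrightarrow> A \<in> carrier_mat 2 2" "length u = length As" "length v = length As"
  shows "tensor_list As $$ (bvec_index u, bvec_index v) =
    (\<Prod>j<length As. (As ! j) $$ (of_bool (u ! j), of_bool (v ! j)))"
  using assms
proof (induction As arbitrary: u v)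
  case Nil
  then show ?case by (simp add: tensor_list_def)
next
  case (Cons A As)
  obtain b u' where u: "u = b # u'" "length u' = length As" using Cons.prems by (cases u) auto
  obtain d v' where v: "v = d # v'" "length v' = length As" using Cons.prems by (cases v) auto
  have A: "A \<in> carrier_mat 2 2" and As: "tensor_list As \<in> carrier_mat (2 ^ length As) (2 ^ length As)"
    using Cons.prems by (auto intro: tensor_list_carrier)
  have less: "bvec_index u' < 2 ^ length As" "bvec_index v' < 2 ^ length As"
    using bvec_index_less u v by metis+
  have "tensor_list (A # As) $$ (bvec_index u, bvec_index v) =
     A $$ (of_bool b, of_bool d) * tensor_list As $$ (bvec_index u', bvec_index v')"
    using A As less bvec_index_less[of u] bvec_index_less[of v] u v
    by (simp add: tensor_list_def kron_def)
  also have "\<dots> = (\<Prod>j<length (A # As). ((A # As) ! j) $$ (of_bool (u ! j), of_bool (v ! j)))"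
    using Cons u v by (simp add: prod.lessThan_Suc_shift del: prod.lessThan_Suc)
  finally show ?case .
qed

text \<open>Each factor has at most one nonzero entry per column, and one wrong bit of the row makes
  the whole product zero. Pauli powers, gates and \<open>zero_proj\<close> all become monomial in
  this way.\<close>

lemma tensor_list_monomial:
  assumes "length As = n" "f \<in> bvecs n \<rightarrow> bvecs n" "\<And>j. j < n \<Longrightarrow> As ! j \<in> carrier_mat 2 2"
    and "\<And>j v x. j < n \<Longrightarrow> length v = n \<Longrightarrow>
      (As ! j) $$ (of_bool x, of_bool (v ! j)) = (if x = f v ! j then h j v else 0)"
  shows "tensor_list As = monomial n (\<lambda>v. \<Prod>j<n. h j v) f"
proof (rule eq_monomialI)
  have carrier: "A \<in> carrier_mat 2 2" if "A \<in> set As" for A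
    using that assms(1,3) by (auto simp: in_set_conv_nth)
  show "tensor_list As \<in> carrier_mat (2 ^ n) (2 ^ n)"
    using tensor_list_carrier[of As] carrier assms(1) by simp
  fix u v :: "bool list" assume uv: "length u = n" "length v = n"
  then have fv: "length (f v) = n" using assms(2) by auto
  have "tensor_list As $$ (bvec_index u, bvec_index v) =
      (\<Prod>j<n. if u ! j = f v ! j then h j v else 0)"
    using uv assms(1,4) carrier by (simp add: index_tensor_list)
  also have "\<dots> = (if u = f v then \<Prod>j<n. h j v else 0)"
  proof (cases "u = f v")
    case False
    then obtain j where "j < n" "u ! j \<noteq> f v ! j" using uv fv by (auto simp: list_eq_iff_nth_eq)
    then show ?thesis using False by (auto intro!: prod_zero bexI[of _ j])
  qed simp
  finally show "tensor_list As $$ (bvec_index u, bvec_index v) =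
      (if u = f v then \<Prod>j<n. h j v else 0)" .
qed (fact assms(2))

section \<open>Addition of bit vectors modulo 2\<close>

definition bxor :: "bool list \<Rightarrow> bool list \<Rightarrow> bool list" where
  "bxor a v = map2 (\<noteq>) a v"

lemma length_bxor [simp]: "length (bxor a v) = min (length a) (length v)"
  by (simp add: bxor_def)

lemma nth_bxor [simp]: "j < length a \<Longrightarrow> j < length v \<Longrightarrow> bxor a v ! j = (a ! j \<noteq> v ! j)"
  by (simp add: bxor_def)

lemma bxor_bvecs [simp, intro]: "length a = n \<Longrightarrow> bxor a \<in> bvecs n \<rightarrow> bvecs n"
  by simp

lemma bxor_assoc: "bxor (bxor a b) c = bxor a (bxor b c)"
  by (rule nth_equalityI) auto

lemma bxor_commute: "bxor a b = bxor b a"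
  by (rule nth_equalityI) auto

lemma bxor_False: "length v = n \<Longrightarrow> bxor v (replicate n False) = v"
  by (rule nth_equalityI) auto

lemma bxor_False_left: "length v = n \<Longrightarrow> bxor (replicate n False) v = v"
  by (rule nth_equalityI) auto

lemma bxor_self: "length v = n \<Longrightarrow> bxor v v = replicate n False"
  by (rule nth_equalityI) auto

lemma bxor_cancel [simp]: "length a = length v \<Longrightarrow> bxor a (bxor a v) = v"
  by (rule nth_equalityI) auto

section \<open>Pauli strings and gates as monomial matrices\<close>

lemma pauli_carrier [simp]: "pauli_X \<in> carrier_mat 2 2" "pauli_Z \<in> carrier_mat 2 2"
  by (auto simp: pauli_X_def pauli_Z_def mat_of_rows_list_def)

lemma dim_pauli [simp]:
  "dim_row pauli_X = 2" "dim_col pauli_X = 2" "dim_row pauli_Z = 2" "dim_col pauli_Z = 2"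
  using pauli_carrier by (simp_all only: carrier_matD)

lemma index_pauli_X: "pauli_X $$ (of_bool x, of_bool y) = (if x = (\<not> y) then 1 else 0)"
  by (cases x; cases y) (auto simp: pauli_X_def mat_of_rows_list_def)

lemma index_one_2: "1\<^sub>m 2 $$ (of_bool x, of_bool y) = (if x = y then 1 else 0 :: complex)"
  by (cases x; cases y) auto

lemma index_pauli_X_pow:
  "(pauli_X ^\<^sub>m of_bool b) $$ (of_bool x, of_bool y) = (if x = (b \<noteq> y) then 1 else 0)"
  by (cases b) (simp_all add: index_pauli_X index_one_2)

lemma index_pauli_Z_pow:
  "(pauli_Z ^\<^sub>m of_bool b) $$ (of_bool x, of_bool y) =
    (if x = y then if b \<and> y then -1 else 1 else 0)"
  by (cases b; cases x; cases y) (auto simp: pauli_Z_def mat_of_rows_list_def)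

lemma dim_ket1 [simp]: "dim_row (ket1 b) = 2" "dim_col (ket1 b) = 1"
  by (simp_all add: ket1_def mat_of_rows_list_def)

lemma ket1_carrier [simp]: "ket1 b \<in> carrier_mat 2 1"
  by (intro carrier_matI) simp_all

lemma index_ket1: "ket1 b $$ (of_bool x, 0) = (if x = b then 1 else 0)"
  by (cases b; cases x) (auto simp: ket1_def mat_of_rows_list_def)

lemma proj1_carrier [simp]: "proj1 b \<in> carrier_mat 2 2"
  by (intro carrier_matI) (simp_all add: proj1_def)

lemma index_outer_product:
  fixes w :: "complex mat"
  assumes "w \<in> carrier_mat m 1" "i < m" "j < m"
  shows "(w * mat_adjoint w) $$ (i, j) = w $$ (i, 0) * cnj (w $$ (j, 0))"
  using assms by (simp add: scalar_prod_def index_mat_adjoint)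

lemma index_proj1:
  "proj1 b $$ (of_bool x, of_bool y) = (if x = y then if y = b then 1 else 0 else 0)"
proof -
  have "of_bool x < (2::nat)" "of_bool y < (2::nat)" by (cases x; cases y; simp)+
  then have "proj1 b $$ (of_bool x, of_bool y) = ket1 b $$ (of_bool x, 0) * cnj (ket1 b $$ (of_bool y, 0))"
    unfolding proj1_def by (intro index_outer_product[OF ket1_carrier])
  then show ?thesis by (simp add: index_ket1)
qed

lemma X_pow_monomial:
  assumes "length a = n"
  shows "X_pow a = monomial n (\<lambda>_. 1) (bxor a)"
proof -
  have "X_pow a = monomial n (\<lambda>v. \<Prod>j<n. 1) (bxor a)"
    unfolding X_pow_def using assms
    by (intro tensor_list_monomial) (auto simp: index_pauli_X_pow intro!: pow_carrier_mat)
  then show ?thesis by simp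
qed

text \<open>The eigenvalue of \<open>Z_pow b\<close> on \<open>ket v\<close>: -1 to the number of
  positions where both bits are set.\<close>

definition z_sign :: "bool list \<Rightarrow> bool list \<Rightarrow> complex" where
  "z_sign b v = (\<Prod>j<length b. if b ! j \<and> v ! j then -1 else 1)"

lemma Z_pow_monomial:
  assumes "length b = n"
  shows "Z_pow b = monomial n (z_sign b) (\<lambda>v. v)"
  unfolding Z_pow_def z_sign_def using assms
  by (subst tensor_list_monomial[where n = n and f = "\<lambda>v. v"
        and h = "\<lambda>j v. if b ! j \<and> v ! j then -1 else 1"])
    (auto simp: index_pauli_Z_pow intro!: pow_carrier_mat)

text \<open>Since \<i> has order 4, the reduction modulo 4 in \<open>bit_dot\<close> does not affect
  the power, which then factors over the qubits.\<close>

lemma imaginary_power_bit_dot: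
  "\<i> ^ bit_dot a b = (\<Prod>j<length a. if a ! j \<and> b ! j then \<i> else 1)"
proof -
  have mod4: "\<i> ^ (m mod 4) = \<i> ^ m" for m
  proof -
    have "\<i> ^ 4 = 1" by (simp add: numeral_eq_Suc)
    then have "\<i> ^ m = \<i> ^ (m mod 4)"
      by (metis div_mult_mod_eq mult.commute mult_1 power_add power_mult power_one)
    then show ?thesis ..
  qed
  show ?thesis
    unfolding bit_dot_def mod4 power_sum by (rule prod.cong) auto
qed

text \<open>The scalar picked up when \<open>pauli a b\<close> sends \<open>ket v\<close> to a
  multiple of \<open>ket (bxor a v)\<close>.\<close>

definition pauli_phase :: "bool list \<Rightarrow> bool list \<Rightarrow> bool list \<Rightarrow> complex" where
  "pauli_phase a b v = \<i> ^ bit_dot a b * z_sign b v"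

definition pauli :: "bool list \<Rightarrow> bool list \<Rightarrow> complex mat" where
  "pauli a b = \<i> ^ bit_dot a b \<cdot>\<^sub>m (X_pow a * Z_pow b)"

lemma pauli_strings_eq: "pauli_strings n = {pauli a b | a b. length a = n \<and> length b = n}"
  by (simp add: pauli_strings_def pauli_def)

lemma pauli_monomial:
  assumes "length a = n" "length b = n"
  shows "pauli a b = monomial n (pauli_phase a b) (bxor a)"
  unfolding pauli_def X_pow_monomial[OF assms(1)] Z_pow_monomial[OF assms(2)]
  using assms by (subst monomial_mult) (auto simp: smult_monomial pauli_phase_def[abs_def])

lemma pauli_phase_nonzero: "pauli_phase a b v \<noteq> 0"
  by (auto simp: pauli_phase_def z_sign_def)

section \<open>Projectors and computational basis states\<close>

lemma zero_proj_monomial: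
  "zero_proj m = monomial m (\<lambda>v. of_bool (v = replicate m False)) (\<lambda>v. v)"
proof -
  have "zero_proj m = monomial m (\<lambda>v. \<Prod>j<m. if v ! j then 0 else 1) (\<lambda>v. v)"
    unfolding zero_proj_def
    by (rule tensor_list_monomial) (auto simp: index_proj1)
  also have "\<dots> = monomial m (\<lambda>v. of_bool (v = replicate m False)) (\<lambda>v. v)"
  proof (rule monomial_cong)
    fix v :: "bool list" assume v: "length v = m"
    show "(\<Prod>j<m. if v ! j then 0 else 1) = (of_bool (v = replicate m False) :: complex)"
    proof (cases "v = replicate m False")
      case False
      then obtain j where "j < m" "v ! j" using v by (auto simp: list_eq_iff_nth_eq)
      then show ?thesis using False by (auto intro!: prod_zero bexI[of _ j])
    qed simp
  qed auto
  finally show ?thesis .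
qed

lemma ket_Cons: "ket (b # bs) = ket1 b \<otimes>\<^sub>K ket bs"
  by (simp add: ket_def tensor_list_def)

lemma ket_carrier [simp]: "ket v \<in> carrier_mat (2 ^ length v) 1"
proof (induction v)
  case (Cons b v)
  then show ?case using ket1_carrier[of b] by (simp add: ket_Cons kron_def)
qed (simp add: ket_def tensor_list_def)

lemma index_ket:
  "length u = length v \<Longrightarrow> ket v $$ (bvec_index u, 0) = (if u = v then 1 else 0)"
proof (induction u v rule: list_induct2)
  case (Cons x xs y ys)
  have less: "bvec_index xs < 2 ^ length ys" "bvec_index (x # xs) < 2 * 2 ^ length ys"
    using bvec_index_less[of xs] bvec_index_less[of "x # xs"] Cons.hyps by auto
  have "ket (y # ys) $$ (bvec_index (x # xs), 0) =
      ket1 y $$ (of_bool x, 0) * ket ys $$ (bvec_index xs, 0)"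
    using less ket1_carrier[of y] ket_carrier[of ys] Cons.hyps by (simp add: ket_Cons kron_def)
  then show ?case using Cons by (simp add: index_ket1)
qed (simp add: ket_def tensor_list_def)

text \<open>\<open>orbit_proj\<close> sums over a set of states; distinct labels must give distinct
  states before that sum can run over labels.\<close>

lemma inj_on_ket: "inj_on ket (bvecs n)"
proof (rule inj_onI)
  fix u v assume uv: "u \<in> bvecs n" "v \<in> bvecs n" "ket u = ket v"
  then have "ket v $$ (bvec_index u, 0) = ket u $$ (bvec_index u, 0)" by simp
  then show "u = v" using uv(1,2) by (auto simp: index_ket split: if_splits)
qed

lemma monomial_mult_ket:
  assumes "f \<in> bvecs n \<rightarrow> bvecs n" "length v = n"
  shows "monomial n (\<lambda>_. 1) f * ket v = ket (f v)"
\<comment> \<open>A state is a matrix with \<open>2 ^ 0\<close> columns, so its column index is that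
  of the empty bit vector.\<close>
proof (rule eq_matI_bvec[where n = n and m = 0])
  have fv: "length (f v) = n" using assms by auto
  have kv: "ket v \<in> carrier_mat (2 ^ n) (2 ^ 0)" "ket (f v) \<in> carrier_mat (2 ^ n) (2 ^ 0)"
    using ket_carrier[of v] ket_carrier[of "f v"] assms fv by simp_all
  show "ket (f v) \<in> carrier_mat (2 ^ n) (2 ^ 0)" by fact
  show "monomial n (\<lambda>_. 1) f * ket v \<in> carrier_mat (2 ^ n) (2 ^ 0)"
    using mult_carrier_mat[OF monomial_carrier kv(1)] .
  fix u v' :: "bool list" assume u: "length u = n" "length v' = 0"
  have "(monomial n (\<lambda>_. 1) f * ket v) $$ (bvec_index u, bvec_index v') =
      (\<Sum>w\<in>bvecs n. if w = v then (if u = f w then 1 else 0) else 0)"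
    using assms u kv
    by (subst index_mult_mat_bvec[where l = n and m = 0 and n = n])
      (auto simp: index_monomial index_ket intro!: sum.cong simp del: sum.delta sum.delta')
  also have "\<dots> = ket (f v) $$ (bvec_index u, bvec_index v')"
    using assms u fv by (simp add: sum.delta index_ket)
  finally show "(monomial n (\<lambda>_. 1) f * ket v) $$ (bvec_index u, bvec_index v') =
      ket (f v) $$ (bvec_index u, bvec_index v')" .
qed

lemma orbit_proj_monomial:
  assumes "S \<subseteq> bvecs n"
  shows "orbit_proj n (ket ` S) = monomial n (\<lambda>v. of_bool (v \<in> S)) (\<lambda>v. v)"
proof (rule eq_monomialI)
  fix u v :: "bool list" assume uv: "length u = n" "length v = n"
  have inj: "inj_on ket S" and fin: "finite S"
    using assms inj_on_ket inj_on_subset finite_subset finite_bvecs by metis+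
  have "orbit_proj n (ket ` S) $$ (bvec_index u, bvec_index v) =
      (\<Sum>w\<in>S. (ket w * mat_adjoint (ket w)) $$ (bvec_index u, bvec_index v))"
    using uv by (simp add: orbit_proj_def sum.reindex[OF inj])
  also have "\<dots> = (\<Sum>w\<in>S. if w = v then (if u = v then 1 else 0) else 0)"
  proof (rule sum.cong)
    fix w assume "w \<in> S"
    then have "length w = n" using assms by auto
    then show "(ket w * mat_adjoint (ket w)) $$ (bvec_index u, bvec_index v) =
        (if w = v then (if u = v then 1 else 0) else 0)"
      using uv ket_carrier[of w] bvec_index_less[of u] bvec_index_less[of v]
      by (subst index_outer_product[where m = "2 ^ n"]) (auto simp: index_ket)
  qed simp
  also have "\<dots> = (if u = v then of_bool (v \<in> S) else 0)"
    using fin by simp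
  finally show "orbit_proj n (ket ` S) $$ (bvec_index u, bvec_index v) =
      (if u = v then of_bool (v \<in> S) else 0)" .
qed (auto simp: orbit_proj_def)

section \<open>Gates and circuits as maps on bit vectors\<close>

fun gate_fun :: "gate \<Rightarrow> bool list \<Rightarrow> bool list" where
  "gate_fun (X_gate q) v = v[q := \<not> v ! q]"
| "gate_fun (CX_gate c t) v = v[t := (v ! t \<noteq> v ! c)]"

lemma length_gate_fun [simp]: "length (gate_fun g v) = length v"
  by (cases g) auto

lemma gate_fun_involutive: "valid_gate (length v) g \<Longrightarrow> gate_fun g (gate_fun g v) = v"
proof (cases g)
  case (CX_gate c t)
  assume "valid_gate (length v) g"
  then show ?thesis
    unfolding CX_gate by (intro nth_equalityI) (auto simp: nth_list_update split: if_splits)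
qed (auto simp: nth_list_update)

lemma gate_mat_monomial:
  assumes "valid_gate n g"
  shows "gate_mat n g = monomial n (\<lambda>_. 1) (gate_fun g)"
proof (cases g)
  case (X_gate q)
  have "gate_mat n g = monomial n (\<lambda>v. \<Prod>j<n. 1) (gate_fun g)"
    using assms unfolding X_gate gate_mat.simps
    by (intro tensor_list_monomial) (auto simp: index_pauli_X index_one_2 nth_list_update)
  then show ?thesis by simp
next
  case (CX_gate c t)
  then have ct: "c < n" "t < n" "c \<noteq> t" using assms by auto
  \<comment> \<open>The CX gate is a sum of two monomial matrices with complementary supports: in
    column \<open>v\<close> the control bit \<open>v ! c\<close> leaves exactly one of the two
    coefficients nonzero.\<close>
  have 1: "tensor_list (map (\<lambda>j. if j = c then proj1 False else 1\<^sub>m 2) [0..<n]) =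
      monomial n (\<lambda>v. \<Prod>j<n. if j = c then if v ! c then 0 else 1 else 1) (\<lambda>v. v)"
    by (rule tensor_list_monomial) (auto simp: index_proj1 index_one_2)
  have 2: "tensor_list (map (\<lambda>j. if j = c then proj1 True else if j = t then pauli_X else 1\<^sub>m 2) [0..<n]) =
      monomial n (\<lambda>v. \<Prod>j<n. if j = c then if v ! c then 1 else 0 else 1) (gate_fun (X_gate t))"
    using ct by (intro tensor_list_monomial)
      (auto simp: index_proj1 index_one_2 index_pauli_X nth_list_update)
  show ?thesis
    unfolding CX_gate gate_mat.simps 1 2
  proof (rule eq_monomialI)
    fix u v :: "bool list" assume uv: "length u = n" "length v = n"
    have maps: "gate_fun (X_gate t) \<in> bvecs n \<rightarrow> bvecs n" "(\<lambda>v. v) \<in> bvecs n \<rightarrow> bvecs n"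
      by auto
    show "(monomial n (\<lambda>v. \<Prod>j<n. if j = c then if v ! c then 0 else 1 else 1) (\<lambda>v. v) +
        monomial n (\<lambda>v. \<Prod>j<n. if j = c then if v ! c then 1 else 0 else 1) (gate_fun (X_gate t)))
        $$ (bvec_index u, bvec_index v) = (if u = gate_fun (CX_gate c t) v then 1 else 0)"
      using uv ct bvec_index_less[of u] bvec_index_less[of v] maps
      by (cases "v ! c") (simp_all add: index_monomial)
  qed auto
qed

text \<open>The head of the list acts last, following the order of the product in
  \<open>circuit_mat\<close>.\<close>

fun circuit_fun :: "gate list \<Rightarrow> bool list \<Rightarrow> bool list" where
  "circuit_fun [] v = v"
| "circuit_fun (g # gs) v = gate_fun g (circuit_fun gs v)"

lemma length_circuit_fun [simp]: "length (circuit_fun gs v) = length v"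
  by (induction gs) auto

lemma circuit_fun_bvecs [simp, intro]: "circuit_fun gs \<in> bvecs n \<rightarrow> bvecs n"
  by auto

lemma circuit_fun_append: "circuit_fun (gs @ hs) v = circuit_fun gs (circuit_fun hs v)"
  by (induction gs) auto

text \<open>Every valid gate is an involution, so the gates in opposite order undo the
  circuit.\<close>

lemma circuit_fun_rev:
  "\<forall>g\<in>set gs. valid_gate (length v) g \<Longrightarrow> circuit_fun (rev gs) (circuit_fun gs v) = v"
  by (induction gs) (auto simp: circuit_fun_append gate_fun_involutive)

lemma circuit_mat_monomial:
  "\<forall>g\<in>set gs. valid_gate n g \<Longrightarrow> circuit_mat n gs = monomial n (\<lambda>_. 1) (circuit_fun gs)"
proof (induction gs)
  case Nil
  then show ?case
    by (auto simp: circuit_mat_def one_mat_monomial intro!: monomial_cong)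
next
  case (Cons g gs)
  have "circuit_mat n (g # gs) = gate_mat n g * circuit_mat n gs" by (simp add: circuit_mat_def)
  also have "\<dots> = monomial n (\<lambda>_. 1) (gate_fun g) * monomial n (\<lambda>_. 1) (circuit_fun gs)"
    using Cons by (simp add: gate_mat_monomial)
  also have "\<dots> = monomial n (\<lambda>_. 1) (circuit_fun (g # gs))"
    by (subst monomial_mult) (auto intro!: monomial_cong)
  finally show ?case .
qed

lemma mat_adjoint_circuit_mat:
  assumes "\<forall>g\<in>set gs. valid_gate n g"
  shows "mat_adjoint (circuit_mat n gs) = monomial n (\<lambda>_. 1) (circuit_fun (rev gs))"
  unfolding circuit_mat_monomial[OF assms]
  using assms circuit_fun_rev[of gs] circuit_fun_rev[of "rev gs"]
  by (intro mat_adjoint_monomial) auto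

lemma bij_betw_circuit_fun:
  assumes "\<forall>g\<in>set gs. valid_gate n g"
  shows "bij_betw (circuit_fun gs) (bvecs n) (bvecs n)"
  using assms circuit_fun_rev[of gs] circuit_fun_rev[of "rev gs"]
  by (intro bij_betw_byWitness[where f' = "circuit_fun (rev gs)"]) auto

lemma permutation_operator_circuit:
  assumes "\<forall>g\<in>set gs. valid_gate n g"
  shows "permutation_operator n (circuit_mat n gs)"
  unfolding permutation_operator_def
proof (intro exI conjI)
  \<comment> \<open>The map on bit vectors is transported to indices and extended by the identity,
    because \<open>permutes\<close> demands fixed points outside the set.\<close>
  define p where "p i = (if i < 2 ^ n then bvec_index (circuit_fun gs (index_bvec n i)) else i)" for i
  have inv: "bij_betw (index_bvec n) {..<2 ^ n} (bvecs n)"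
    unfolding index_bvec_def by (rule bij_betw_inv_into[OF bij_betw_bvec_index])
  have "bij_betw (bvec_index \<circ> (circuit_fun gs \<circ> index_bvec n)) {..<2 ^ n} {..<2 ^ n}"
    by (intro bij_betw_trans[OF bij_betw_trans[OF inv bij_betw_circuit_fun[OF assms]]
        bij_betw_bvec_index])
  then have "bij_betw p {..<2 ^ n} {..<2 ^ n}"
    by (rule bij_betw_cong[THEN iffD1, rotated]) (auto simp: p_def)
  then show "p permutes {..<2 ^ n}"
    by (rule bij_imp_permutes) (auto simp: p_def)
  show "circuit_mat n gs = mat (2 ^ n) (2 ^ n) (\<lambda>(i, j). if i = p j then 1 else 0)"
    unfolding circuit_mat_monomial[OF assms] by (rule eq_matI) (auto simp: monomial_def p_def)
qed

section \<open>Pauli X-orbits as affine subspaces\<close>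

text \<open>The linear span of \<open>S\<close> over the field with two elements, where sums of
  generators already give all linear combinations. The parameter \<open>n\<close> supplies the
  length of the zero vector.\<close>

inductive_set bspan :: "nat \<Rightarrow> bool list set \<Rightarrow> bool list set" for n S where
  zero: "replicate n False \<in> bspan n S"
| add: "x \<in> S \<Longrightarrow> v \<in> bspan n S \<Longrightarrow> bxor x v \<in> bspan n S"

lemma length_bspan: "v \<in> bspan n S \<Longrightarrow> S \<subseteq> bvecs n \<Longrightarrow> length v = n"
  by (induction rule: bspan.induct) auto

lemma bspan_bxor:
  assumes "u \<in> bspan n S" "v \<in> bspan n S" "S \<subseteq> bvecs n"
  shows "bxor u v \<in> bspan n S"
  using assms
proof (induction rule: bspan.induct)
  case zero
  then show ?case by (simp add: bxor_False_left length_bspan)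
next
  case (add x w)
  then show ?case by (simp add: bxor_assoc bspan.add)
qed

lemma bspan_superset: "S \<subseteq> bvecs n \<Longrightarrow> x \<in> S \<Longrightarrow> x \<in> bspan n S"
  using bspan.add[OF _ bspan.zero, of x S n] by (auto simp: bxor_False)

lemma bspan_mono: "S \<subseteq> T \<Longrightarrow> bspan n S \<subseteq> bspan n T"
proof
  fix v assume "v \<in> bspan n S" "S \<subseteq> T"
  then show "v \<in> bspan n T" by (induction rule: bspan.induct) (auto intro: bspan.intros)
qed

text \<open>The only multiples of \<open>x\<close> are zero and \<open>x\<close>, and adding
  \<open>x\<close> twice cancels, so a new generator contributes just one further coset.\<close>

lemma bspan_insert:
  assumes "x \<in> bvecs n" "S \<subseteq> bvecs n"
  shows "bspan n (insert x S) = bspan n S \<union> bxor x ` bspan n S"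
proof (intro equalityI subsetI)
  fix v assume "v \<in> bspan n (insert x S)"
  then show "v \<in> bspan n S \<union> bxor x ` bspan n S"
  proof (induction rule: bspan.induct)
    case zero
    then show ?case by (simp add: bspan.zero)
  next
    case (add y v)
    show ?case
    proof (cases "y = x")
      case True
      from add.IH show ?thesis
      proof
        assume "v \<in> bxor x ` bspan n S"
        then obtain w where "w \<in> bspan n S" "v = bxor x w" by blast
        then show ?thesis using True assms length_bspan[of w n S] by simp
      qed (use True in auto)
    next
      case False
      then have y: "y \<in> S" using add.hyps by auto
      from add.IH show ?thesis
      proof
        assume "v \<in> bxor x ` bspan n S"
        then obtain w where w: "w \<in> bspan n S" "v = bxor x w" by blast
        have "bxor y v = bxor x (bxor y w)"
          unfolding w by (metis bxor_assoc bxor_commute)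
        then show ?thesis using bspan.add[OF y w(1)] by auto
      qed (use bspan.add[OF y] in auto)
    qed
  qed
next
  fix v assume "v \<in> bspan n S \<union> bxor x ` bspan n S"
  then show "v \<in> bspan n (insert x S)"
    using bspan_mono[of S "insert x S" n] by (auto intro: bspan.add)
qed

lemma bspan_absorb:
  assumes "x \<in> bspan n S" "S \<subseteq> bvecs n"
  shows "bspan n (insert x S) = bspan n S"
  using assms bspan_bxor[OF assms(1) _ assms(2)] length_bspan[OF assms]
  by (subst bspan_insert) auto

lemma bspan_empty: "bspan n {} = {replicate n False}"
  by (auto elim: bspan.cases intro: bspan.zero)

section \<open>The group generated by X strings\<close>

lemma X_pow_mult:
  assumes "length a = n" "length b = n"
  shows "X_pow a * X_pow b = X_pow (bxor a b)"
  using assms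
  by (subst (1 2 3) X_pow_monomial[where n = n])
    (auto simp: monomial_mult bxor_assoc intro!: monomial_cong)

lemma X_pow_False: "X_pow (replicate n False) = 1\<^sub>m (2 ^ n)"
  unfolding one_mat_monomial
  by (subst X_pow_monomial[where n = n]) (auto simp: bxor_False_left intro!: monomial_cong)

lemma X_pow_carrier: "length a = n \<Longrightarrow> X_pow a \<in> carrier_mat (2 ^ n) (2 ^ n)"
  by (simp add: X_pow_monomial)

lemma inj_on_X_pow: "inj_on X_pow (bvecs n)"
proof (rule inj_onI)
  fix a b assume ab: "a \<in> bvecs n" "b \<in> bvecs n" "X_pow a = X_pow b"
  then have "monomial n (\<lambda>_. 1) (bxor a) = monomial n (\<lambda>_. 1) (bxor b)"
    using X_pow_monomial[of a n] X_pow_monomial[of b n] by simp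
  from monomial_eqD[OF this, of "replicate n False"] show "a = b"
    using ab by (auto simp: bxor_False split: if_splits)
qed

lemma GL_simps:
  "(\<otimes>\<^bsub>GL n\<^esub>) = (*)" "\<one>\<^bsub>GL n\<^esub> = 1\<^sub>m (2 ^ n)"
  "carrier (GL n) = Units (ring_mat TYPE(complex) (2 ^ n) ())"
  by (simp_all add: GL_def units_of_mult units_of_one units_of_carrier ring_mat_simps)

lemma group_GL: "group (GL n)"
proof -
  interpret ring "ring_mat TYPE(complex) (2 ^ n) ()" by (rule ring_mat)
  show ?thesis unfolding GL_def by (rule units_group)
qed

lemma X_pow_GL:
  assumes "length a = n"
  shows "X_pow a \<in> carrier (GL n)" and "inv\<^bsub>GL n\<^esub> (X_pow a) = X_pow a"
proof -
  have self: "X_pow a * X_pow a = 1\<^sub>m (2 ^ n)"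
    using assms by (simp add: X_pow_mult bxor_self X_pow_False)
  show GL: "X_pow a \<in> carrier (GL n)"
    unfolding GL_simps Units_def ring_mat_simps
    using self X_pow_carrier[OF assms] by auto
  show "inv\<^bsub>GL n\<^esub> (X_pow a) = X_pow a"
    by (rule group.inv_equality[OF group_GL _ GL GL]) (simp add: GL_simps self)
qed

lemma generate_X_pow:
  assumes "S \<subseteq> bvecs n"
  shows "generate (GL n) (X_pow ` S) = X_pow ` bspan n S"
proof (intro equalityI subsetI)
  fix h assume "h \<in> generate (GL n) (X_pow ` S)"
  then show "h \<in> X_pow ` bspan n S"
  proof (induction rule: generate.induct)
    case one
    show ?case using bspan.zero by (force simp: GL_simps X_pow_False[symmetric])
  next
    case (incl h)
    then show ?case using bspan_superset[OF assms] by auto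
  next
    case (inv h)
    then obtain x where "x \<in> S" "h = X_pow x" by auto
    then show ?case using bspan_superset[OF assms] X_pow_GL(2)[of x n] assms by auto
  next
    case (eng h1 h2)
    then obtain u v where "u \<in> bspan n S" "v \<in> bspan n S" "h1 = X_pow u" "h2 = X_pow v" by auto
    then show ?case
      using assms by (simp add: GL_simps X_pow_mult length_bspan bspan_bxor)
  qed
next
  fix h assume "h \<in> X_pow ` bspan n S"
  then obtain v where v: "v \<in> bspan n S" "h = X_pow v" by blast
  from v(1) have "X_pow v \<in> generate (GL n) (X_pow ` S)"
  proof (induction rule: bspan.induct)
    case zero
    show ?case using generate.one[of "GL n" "X_pow ` S"] by (simp add: GL_simps X_pow_False)
  next
    case (add x v)
    have "X_pow x * X_pow v \<in> generate (GL n) (X_pow ` S)"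
      using generate.eng[OF generate.incl add.IH, of "X_pow x"] add.hyps by (simp add: GL_simps)
    then show ?case
      using add.hyps assms length_bspan[OF _ assms] X_pow_mult[of x n v] by auto
  qed
  then show "h \<in> generate (GL n) (X_pow ` S)" using v by simp
qed

section \<open>Minimal generating sets as linearly independent vectors\<close>

lemma IX_strings_subset: "IX_strings n \<subseteq> X_pow ` bvecs n"
proof
  fix A assume "A \<in> IX_strings n"
  then obtain As where As: "A = tensor_list As" "length As = n" "set As \<subseteq> {1\<^sub>m 2, pauli_X}"
    by (auto simp: IX_strings_def)
  \<comment> \<open>Each factor is encoded by whether it is \<open>pauli_X\<close>; the power with
    exponent 0 gives back the identity.\<close>
  have "map (\<lambda>b. pauli_X ^\<^sub>m of_bool b) (map (\<lambda>B. B = pauli_X) As) = map (\<lambda>B. B) As"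
    unfolding map_map using As(3) by (intro map_cong) auto
  then have "A = X_pow (map (\<lambda>B. B = pauli_X) As)"
    by (simp add: X_pow_def As(1))
  then show "A \<in> X_pow ` bvecs n" using As(2) by auto
qed

text \<open>Linear independence in ordered form: each vector is tested only against the span of its
  predecessors, as elimination one vector at a time requires.\<close>

definition bindep :: "nat \<Rightarrow> bool list list \<Rightarrow> bool" where
  "bindep n xs \<longleftrightarrow> set xs \<subseteq> bvecs n \<and> (\<forall>i<length xs. xs ! i \<notin> bspan n (set (take i xs)))"

lemma bindep_snoc:
  "bindep n (xs @ [x]) \<longleftrightarrow> bindep n xs \<and> length x = n \<and> x \<notin> bspan n (set xs)"
  by (auto simp: bindep_def nth_append less_Suc_eq all_conj_distrib)

text \<open>A vector in the span of its predecessors could be deleted without changing the generated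
  group, against minimality.\<close>

lemma minimal_X_generatorsE:
  assumes "minimal_X_generators n Xs"
  obtains xs where "Xs = map X_pow xs" "bindep n xs"
proof -
  have sub: "set Xs \<subseteq> X_pow ` bvecs n" and dist: "distinct Xs"
    and min: "\<And>H. H \<subset> set Xs \<Longrightarrow> generate (GL n) H \<noteq> X_group n Xs"
    using assms IX_strings_subset[of n] unfolding minimal_X_generators_def by blast+
  define xs where "xs = map (inv_into (bvecs n) X_pow) Xs"
  have Xs: "Xs = map X_pow xs"
    unfolding xs_def map_map using sub by (intro map_idI[symmetric]) (auto intro: f_inv_into_f)
  have xs: "set xs \<subseteq> bvecs n"
    unfolding xs_def set_map using sub inv_into_into[of _ X_pow "bvecs n"] by blast
  have "xs ! i \<notin> bspan n (set (take i xs))" if "i < length xs" for i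
  proof
    assume *: "xs ! i \<in> bspan n (set (take i xs))"
    define T where "T = set xs - {xs ! i}"
    \<comment> \<open>Distinctness ensures that removing \<open>xs ! i\<close> from the set does not
      remove any of its predecessors.\<close>
    have "distinct xs" using dist Xs by (simp add: distinct_map)
    then have "xs ! i \<notin> set (take i xs)"
      using that by (auto simp: in_set_conv_nth nth_eq_iff_index_eq)
    then have "set (take i xs) \<subseteq> T"
      by (auto simp: T_def dest: in_set_takeD)
    then have "xs ! i \<in> bspan n T" using * bspan_mono by blast
    moreover have T: "T \<subseteq> bvecs n" "insert (xs ! i) T = set xs"
      using xs that by (auto simp: T_def)
    ultimately have "bspan n (set xs) = bspan n T" using bspan_absorb by metis
    then have "generate (GL n) (X_pow ` T) = X_group n Xs"
      using T xs by (simp add: X_group_def Xs generate_X_pow)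
    moreover have "X_pow ` T \<subset> set Xs"
    proof
      show "X_pow ` T \<subseteq> set Xs" using T by (auto simp: Xs)
      have "X_pow (xs ! i) \<notin> X_pow ` T"
        using inj_on_image_mem_iff[OF inj_on_X_pow _ T(1), of "xs ! i"] xs nth_mem[OF that]
        unfolding T_def by blast
      then show "X_pow ` T \<noteq> set Xs" using that by (auto simp: Xs)
    qed
    ultimately show False using min by blast
  qed
  then show ?thesis using that[OF Xs] xs by (simp add: bindep_def)
qed

lemma X_orbit_eq:
  assumes "set xs \<subseteq> bvecs n" "length z = n"
  shows "X_orbit n (map X_pow xs) z = ket ` bxor z ` bspan n (set xs)"
  unfolding X_orbit_def X_group_def set_map generate_X_pow[OF assms(1)] image_image
proof (rule image_cong)
  fix v assume "v \<in> bspan n (set xs)"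
  then have "length v = n" using assms length_bspan by blast
  then show "X_pow v * ket z = ket (bxor z v)"
    using assms(2) by (simp add: X_pow_monomial monomial_mult_ket bxor_commute)
qed simp

section \<open>Gaussian elimination by CX gates\<close>

text \<open>The coordinate subspace of the first \<open>k\<close> positions. For \<open>k\<close> at
  most \<open>n\<close> its projector is the identity on the first \<open>k\<close> qubits tensored
  with \<open>zero_proj (n - k)\<close>, hence it is the target of the elimination.\<close>

definition low_bvecs :: "nat \<Rightarrow> nat \<Rightarrow> bool list set" where
  "low_bvecs n k = {v. length v = n \<and> (\<forall>j<n. k \<le> j \<longrightarrow> \<not> v ! j)}"

text \<open>The control is not among the targets, so its bit never changes and every gate reads the
  same value.\<close>

lemma nth_circuit_fun_fanout:
  assumes "c < length v" "c \<notin> set ts" "distinct ts" "\<forall>t\<in>set ts. t < length v" "j < length v"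
  shows "circuit_fun (map (CX_gate c) ts) v ! j = (v ! j \<noteq> (j \<in> set ts \<and> v ! c))"
  using assms
proof (induction ts arbitrary: j)
  case (Cons t ts)
  then show ?case by (auto simp: nth_list_update)
qed simp

text \<open>CX gates act linearly, whereas X gates are translations; the elimination depends on
  linearity.\<close>

definition cx_circuit :: "nat \<Rightarrow> gate list \<Rightarrow> bool" where
  "cx_circuit n gs \<longleftrightarrow> (\<forall>g\<in>set gs. \<exists>c t. g = CX_gate c t \<and> c < n \<and> t < n \<and> c \<noteq> t)"

lemma cx_circuit_valid: "cx_circuit n gs \<Longrightarrow> g \<in> set gs \<Longrightarrow> valid_gate n g"
  by (auto simp: cx_circuit_def)

lemma cx_circuit_append: "cx_circuit n (gs @ hs) \<longleftrightarrow> cx_circuit n gs \<and> cx_circuit n hs"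
  by (auto simp: cx_circuit_def)

lemma cx_circuit_fun_bxor:
  assumes "cx_circuit n gs" "length u = n" "length v = n"
  shows "circuit_fun gs (bxor u v) = bxor (circuit_fun gs u) (circuit_fun gs v)"
  using assms
proof (induction gs)
  case (Cons g gs)
  then obtain c t where g: "g = CX_gate c t" "c < n" "t < n" "cx_circuit n gs"
    by (auto simp: cx_circuit_def)
  have "circuit_fun (g # gs) (bxor u v) = gate_fun g (bxor (circuit_fun gs u) (circuit_fun gs v))"
    using Cons g by simp
  also have "\<dots> = bxor (gate_fun g (circuit_fun gs u)) (gate_fun g (circuit_fun gs v))"
    using g Cons.prems by (intro nth_equalityI) (auto simp: nth_list_update)
  finally show ?case by simp
qed simp

lemma inj_on_circuit_fun:
  "\<forall>g\<in>set gs. valid_gate n g \<Longrightarrow> inj_on (circuit_fun gs) (bvecs n)"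
  using bij_betw_circuit_fun bij_betw_imp_inj_on by blast

text \<open>Some bit \<open>p\<close> of \<open>y\<close> from position \<open>k\<close> on is set.
  If bit \<open>k\<close> is not, a CX gate from \<open>p\<close> sets it; CX gates from
  \<open>k\<close> then clear all other bits. Vectors in \<open>low_bvecs n k\<close> have both
  control bits zero and stay fixed.\<close>

lemma pivot_circuit:
  assumes "length y = n" "y \<notin> low_bvecs n k"
  obtains hs where "k < n" "cx_circuit n hs" "length hs \<le> n"
    "circuit_fun hs y = (replicate n False)[k := True]"
    "\<And>w. w \<in> low_bvecs n k \<Longrightarrow> circuit_fun hs w = w"
proof -
  obtain p where p: "k \<le> p" "p < n" "y ! p" using assms by (auto simp: low_bvecs_def)
  define pre where "pre = (if y ! k then [] else [CX_gate p k])"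
  define y' where "y' = circuit_fun pre y"
  have y': "length y' = n" "y' ! k" "cx_circuit n pre"
    using p assms by (auto simp: y'_def pre_def cx_circuit_def)
  define ts where "ts = filter (\<lambda>j. j \<noteq> k \<and> y' ! j) [0..<n]"
  define post where "post = map (CX_gate k) ts"
  have ts: "k \<notin> set ts" "distinct ts" "\<forall>t\<in>set ts. t < n" by (auto simp: ts_def)
  \<comment> \<open>Leaving out \<open>k\<close> saves one gate, which makes room for the possible
    gate in \<open>pre\<close>.\<close>
  have "length ts = card (set ts)" using ts(2) by (simp add: distinct_card)
  also have "\<dots> \<le> card ({..<n} - {k})" by (intro card_mono) (auto simp: ts_def)
  also have "\<dots> = n - 1" using p by simp
  finally have len: "length ts \<le> n - 1" .
  have fan: "circuit_fun post v ! j = (v ! j \<noteq> (j \<in> set ts \<and> v ! k))"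
    if "length v = n" "j < n" for v j
    unfolding post_def using nth_circuit_fun_fanout[OF _ ts(1,2), of v j] ts(3) p that by simp
  show ?thesis
  proof
    show "k < n" using p by simp
    show "cx_circuit n (post @ pre)"
      using y' ts p by (auto simp: cx_circuit_append) (auto simp: cx_circuit_def post_def)
    show "length (post @ pre) \<le> n" using len p by (auto simp: post_def pre_def)
    show "circuit_fun (post @ pre) y = (replicate n False)[k := True]"
      unfolding circuit_fun_append y'_def[symmetric] using y' p
      by (intro nth_equalityI) (auto simp: fan ts_def nth_list_update)
    fix w assume w: "w \<in> low_bvecs n k"
    then have len: "length w = n" and wk: "\<not> w ! k" "\<not> w ! p" using p by (auto simp: low_bvecs_def)
    \<comment> \<open>With a false control bit the gate writes \<open>w ! k\<close> back to its own
      place.\<close>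
    have "circuit_fun pre w = w"
      using wk list_update_id[of w k] by (simp add: pre_def)
    then show "circuit_fun (post @ pre) w = w"
      unfolding circuit_fun_append using wk len by (auto intro!: nth_equalityI simp: fan)
  qed
qed

text \<open>The counterpart of \<open>bspan_insert\<close>: the coordinate subspace grows by the
  coset of a unit vector, just as the span grows by the coset of a new generator.\<close>

lemma low_bvecs_Suc:
  assumes "k < n"
  defines "e \<equiv> (replicate n False)[k := True]"
  shows "low_bvecs n (Suc k) = low_bvecs n k \<union> bxor e ` low_bvecs n k"
proof (intro equalityI subsetI)
  fix w assume w: "w \<in> low_bvecs n (Suc k)"
  then have len: "length w = n" by (simp add: low_bvecs_def)
  show "w \<in> low_bvecs n k \<union> bxor e ` low_bvecs n k"
  proof (cases "w ! k")
    case True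
    have "bxor e w \<in> low_bvecs n k"
      using w True by (auto simp: low_bvecs_def e_def nth_list_update)
    moreover have "w = bxor e (bxor e w)" using len by (simp add: e_def)
    ultimately show ?thesis by blast
  next
    case False
    then show ?thesis using w by (auto simp: low_bvecs_def Suc_le_eq order_le_less)
  qed
next
  fix w assume "w \<in> low_bvecs n k \<union> bxor e ` low_bvecs n k"
  then show "w \<in> low_bvecs n (Suc k)"
    by (auto simp: low_bvecs_def e_def nth_list_update)
qed

text \<open>Gaussian elimination, one vector at a time: since the part of the circuit built so far
  maps the span of the earlier vectors onto the first coordinates, the image of the new vector
  has a pivot outside of them.\<close>

lemma gaussian_elimination:
  assumes "bindep n xs"
  shows "length xs \<le> n \<and> (\<exists>gs. cx_circuit n gs \<and> length gs \<le> n * length xs \<and>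
    circuit_fun gs ` bspan n (set xs) = low_bvecs n (length xs))"
  using assms
proof (induction xs rule: rev_induct)
  case Nil
  have "low_bvecs n 0 = {replicate n False}"
    by (auto simp: low_bvecs_def intro!: nth_equalityI)
  then show ?case by (auto simp: bspan_empty cx_circuit_def intro!: exI[of _ "[]"])
next
  case (snoc x xs)
  let ?k = "length xs"
  have x: "length x = n" "x \<notin> bspan n (set xs)" and xs: "set xs \<subseteq> bvecs n" "bindep n xs"
    using snoc.prems by (auto simp: bindep_snoc) (auto simp: bindep_def)
  obtain gs where gs: "cx_circuit n gs" "length gs \<le> n * ?k"
      "circuit_fun gs ` bspan n (set xs) = low_bvecs n ?k"
    using snoc.IH xs(2) by blast
  have "circuit_fun gs x \<notin> low_bvecs n ?k"
    unfolding gs(3)[symmetric]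
    using inj_on_image_mem_iff[OF inj_on_circuit_fun, of gs n x "bspan n (set xs)"]
      cx_circuit_valid[OF gs(1)] x length_bspan[OF _ xs(1)] by (auto simp: subset_iff)
  then obtain hs where hs: "?k < n" "cx_circuit n hs" "length hs \<le> n"
      "circuit_fun hs (circuit_fun gs x) = (replicate n False)[?k := True]"
      "\<And>w. w \<in> low_bvecs n ?k \<Longrightarrow> circuit_fun hs w = w"
    using pivot_circuit[of "circuit_fun gs x" n ?k] x(1) by auto
  let ?f = "circuit_fun (hs @ gs)"
  have cx: "cx_circuit n (hs @ gs)" using hs gs by (simp add: cx_circuit_append)
  have low: "circuit_fun gs v \<in> low_bvecs n ?k" if "v \<in> bspan n (set xs)" for v
    using gs(3) that by blast
  have "?f ` bspan n (set xs) = circuit_fun gs ` bspan n (set xs)"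
    by (intro image_cong) (auto simp: circuit_fun_append hs(5) low)
  then have 1: "?f ` bspan n (set xs) = low_bvecs n ?k" using gs(3) by simp
  \<comment> \<open>By linearity the coset of \<open>x\<close> goes to the coset of its image, which
    the pivot circuit has made the unit vector at position \<open>?k\<close>.\<close>
  have "?f ` bxor x ` bspan n (set xs) = bxor (?f x) ` ?f ` bspan n (set xs)"
    unfolding image_image
    by (intro image_cong) (auto simp: cx_circuit_fun_bxor[OF cx] x length_bspan[OF _ xs(1)])
  then have 2: "?f ` bxor x ` bspan n (set xs) =
      bxor ((replicate n False)[?k := True]) ` low_bvecs n ?k"
    unfolding 1 by (simp add: circuit_fun_append hs(4))
  have "?f ` bspan n (set (xs @ [x])) = low_bvecs n (Suc ?k)"
    using x(1) xs(1) by (simp add: bspan_insert image_Un 1 2 low_bvecs_Suc[OF hs(1)])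
  moreover have "length (hs @ gs) \<le> n * length (xs @ [x])" using hs(3) gs(2) by simp
  ultimately show ?case using cx hs(1) by (metis Suc_leI length_append_singleton)
qed

lemma circuit_fun_X_gates:
  assumes "length z = n" "length v = n"
  shows "circuit_fun (map X_gate (filter (\<lambda>j. z ! j) [0..<n])) v = bxor z v"
proof -
  \<comment> \<open>Generalised to any list of distinct qubits for the induction; distinctness means
    that no bit is flipped twice.\<close>
  have "circuit_fun (map X_gate qs) v ! j = (v ! j \<noteq> (j \<in> set qs))"
    if "distinct qs" "set qs \<subseteq> {..<n}" "j < n" for qs j
    using that
  proof (induction qs arbitrary: j)
    case (Cons q qs)
    then show ?case using assms by (auto simp: nth_list_update)
  qed simp
  from this[of "filter (\<lambda>j. z ! j) [0..<n]"] show ?thesis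
    using assms by (intro nth_equalityI) auto
qed

text \<open>The X gates stand at the end of the list and act first: they move the translate by
  \<open>z\<close> back to the linear span, where the elimination applies.\<close>

lemma bspan_translate_circuit:
  assumes "bindep n xs" "length z = n" "length xs \<ge> 1"
  obtains gs where "\<forall>g\<in>set gs. valid_gate n g" "length gs \<le> 2 * (n * length xs)"
    "circuit_fun gs ` bxor z ` bspan n (set xs) = low_bvecs n (length xs)"
proof -
  obtain gs where gs: "cx_circuit n gs" "length gs \<le> n * length xs"
      "circuit_fun gs ` bspan n (set xs) = low_bvecs n (length xs)"
    using gaussian_elimination[OF assms(1)] by blast
  define hs where "hs = map X_gate (filter (\<lambda>j. z ! j) [0..<n])"
  have xs: "set xs \<subseteq> bvecs n" using assms by (simp add: bindep_def)
  show ?thesis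
  proof
    show "\<forall>g\<in>set (gs @ hs). valid_gate n g"
      using cx_circuit_valid[OF gs(1)] by (auto simp: hs_def)
    \<comment> \<open>There is at most one X gate per qubit, and at least one generator, so these
      gates fit into a second \<open>n * length xs\<close>.\<close>
    have "length hs \<le> n * 1" unfolding hs_def by (simp add: order_trans[OF length_filter_le])
    also have "\<dots> \<le> n * length xs" using assms(3) by (intro mult_le_mono) auto
    finally show "length (gs @ hs) \<le> 2 * (n * length xs)" using gs(2) by simp
    have "circuit_fun (gs @ hs) ` bxor z ` bspan n (set xs) = circuit_fun gs ` bspan n (set xs)"
      unfolding image_image
    proof (rule image_cong)
      fix v assume "v \<in> bspan n (set xs)"
      then have "length v = n" using length_bspan xs by blast
      then show "circuit_fun (gs @ hs) (bxor z v) = circuit_fun gs v"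
        using assms(2) by (simp add: circuit_fun_append hs_def circuit_fun_X_gates)
    qed simp
    then show "circuit_fun (gs @ hs) ` bxor z ` bspan n (set xs) = low_bvecs n (length xs)"
      using gs(3) by simp
  qed
qed

section \<open>Conjugation of Pauli strings by circuits\<close>

lemma prod_lessThan_remove2:
  fixes F :: "nat \<Rightarrow> complex"
  assumes "c < n" "t < n" "c \<noteq> t"
  shows "(\<Prod>j<n. F j) = F c * F t * (\<Prod>j\<in>{..<n} - {c} - {t}. F j)"
  using assms
  by (subst prod.remove[of _ c]; simp) (subst prod.remove[of _ t]; simp)

text \<open>In terms of maps and phases, conjugating \<open>pauli a b\<close> by a gate gives
  \<open>s\<close> times \<open>pauli a' b'\<close>. An X gate only contributes a sign, from a Z on
  its qubit. A CX gate copies X parts from control to target and Z parts from target to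
  control.\<close>

lemma gate_conjugation:
  assumes "valid_gate n g" "length a = n" "length b = n"
  shows "\<exists>a' b' s. length a' = n \<and> length b' = n \<and> s \<in> {1, -1} \<and>
    (\<forall>v. length v = n \<longrightarrow> gate_fun g (bxor a (gate_fun g v)) = bxor a' v \<and>
      pauli_phase a b (gate_fun g v) = s * pauli_phase a' b' v)"
proof (cases g)
  case (X_gate q)
  then have q: "q < n" using assms by simp
  show ?thesis
  proof (intro exI conjI allI impI)
    show "(if b ! q then -1 else 1 :: complex) \<in> {1, -1}" by simp
    fix v :: "bool list" assume v: "length v = n"
    show "gate_fun g (bxor a (gate_fun g v)) = bxor a v"
      using X_gate v q assms by (intro nth_equalityI) (auto simp: nth_list_update)
    have "(\<Prod>j\<in>{..<n} - {q}. if b ! j \<and> gate_fun g v ! j then -1 else 1 :: complex) =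
        (\<Prod>j\<in>{..<n} - {q}. if b ! j \<and> v ! j then -1 else 1)"
      using X_gate by (intro prod.cong) auto
    then show "pauli_phase a b (gate_fun g v) = (if b ! q then -1 else 1) * pauli_phase a b v"
      using X_gate v q assms
      by (simp add: pauli_phase_def z_sign_def prod.remove[of "{..<n}" q])
  qed (use assms in auto)
next
  case (CX_gate c t)
  then have ct: "c < n" "t < n" "c \<noteq> t" using assms by auto
  define a' where "a' = a[t := (a ! t \<noteq> a ! c)]"
  define b' where "b' = b[c := (b ! c \<noteq> b ! t)]"
  have len: "length a' = n" "length b' = n" using assms by (auto simp: a'_def b'_def)
  \<comment> \<open>The products at \<open>c\<close> and \<open>t\<close> change in sum by an even
    number, so the powers of \<i> differ at most by a sign. The other positions are
    untouched.\<close>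
  have "\<exists>s\<in>{1, -1}. \<i> ^ bit_dot a b = s * \<i> ^ bit_dot a' b'"
  proof -
    let ?h = "\<lambda>a b j. if a ! j \<and> b ! j then \<i> else 1"
    have rest: "prod (?h a b) ({..<n} - {c} - {t}) = prod (?h a' b') ({..<n} - {c} - {t})"
      by (intro prod.cong) (auto simp: a'_def b'_def)
    have "\<exists>s\<in>{1, -1}. ?h a b c * ?h a b t = s * (?h a' b' c * ?h a' b' t)"
      using ct assms by (cases "a ! c"; cases "b ! c"; cases "a ! t"; cases "b ! t";
          simp add: a'_def b'_def)
    then obtain s where s: "s \<in> {1, -1}" "?h a b c * ?h a b t = s * (?h a' b' c * ?h a' b' t)"
      by blast
    have "prod (?h a b) {..<n} = s * prod (?h a' b') {..<n}"
      unfolding prod_lessThan_remove2[OF ct] rest s(2) by (rule mult.assoc)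
    then show ?thesis
      using s(1) assms len by (intro bexI[of _ s]) (simp_all only: imaginary_power_bit_dot)
  qed
  then obtain s where s: "s \<in> {1, -1}" "\<i> ^ bit_dot a b = s * \<i> ^ bit_dot a' b'" by blast
  show ?thesis
  proof (intro exI conjI allI impI)
    fix v :: "bool list" assume v: "length v = n"
    show "gate_fun g (bxor a (gate_fun g v)) = bxor a' v"
      unfolding CX_gate a'_def
      using v ct assms by (intro nth_equalityI) (auto simp: nth_list_update)
    let ?h = "\<lambda>b v j. if b ! j \<and> v ! j then -1 else 1 :: complex"
    have "prod (?h b (gate_fun g v)) ({..<n} - {c} - {t}) = prod (?h b' v) ({..<n} - {c} - {t})"
      by (intro prod.cong) (auto simp: CX_gate b'_def)
    \<comment> \<open>Adding the control of \<open>v\<close> to its target is transposed to adding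
      the target of \<open>b\<close> to its control, so the parity of the common bits is the
      same.\<close>
    moreover have "?h b (gate_fun g v) c * ?h b (gate_fun g v) t = ?h b' v c * ?h b' v t"
      using ct assms v by (auto simp: CX_gate b'_def nth_list_update)
    ultimately have "z_sign b (gate_fun g v) = z_sign b' v"
      using assms len by (simp add: z_sign_def prod_lessThan_remove2[OF ct])
    then show "pauli_phase a b (gate_fun g v) = s * pauli_phase a' b' v"
      using s(2) by (simp add: pauli_phase_def)
  qed (use len s in auto)
qed

text \<open>The reversed circuit is the inverse, so conjugation proceeds gate by gate from the
  inside, and the signs multiply.\<close>

lemma circuit_conjugation:
  assumes "\<forall>g\<in>set gs. valid_gate n g" "length a = n" "length b = n"
  shows "\<exists>a' b' s. length a' = n \<and> length b' = n \<and> s \<in> {1, -1} \<and>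
    (\<forall>v. length v = n \<longrightarrow> circuit_fun gs (bxor a (circuit_fun (rev gs) v)) = bxor a' v \<and>
      pauli_phase a b (circuit_fun (rev gs) v) = s * pauli_phase a' b' v)"
  using assms(1)
proof (induction gs)
  case Nil
  show ?case using assms by (intro exI[of _ a] exI[of _ b] exI[of _ 1]) simp
next
  case (Cons g gs)
  then obtain a' b' s where IH: "length a' = n" "length b' = n" "s \<in> {1, -1}"
      "\<And>v. length v = n \<Longrightarrow> circuit_fun gs (bxor a (circuit_fun (rev gs) v)) = bxor a' v"
      "\<And>v. length v = n \<Longrightarrow> pauli_phase a b (circuit_fun (rev gs) v) = s * pauli_phase a' b' v"
    by (metis list.set_intros(2))
  obtain a'' b'' s' where g: "length a'' = n" "length b'' = n" "s' \<in> {1, -1}"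
      "\<And>v. length v = n \<Longrightarrow> gate_fun g (bxor a' (gate_fun g v)) = bxor a'' v"
      "\<And>v. length v = n \<Longrightarrow> pauli_phase a' b' (gate_fun g v) = s' * pauli_phase a'' b'' v"
    using gate_conjugation[OF _ IH(1,2), of g] Cons.prems by (metis list.set_intros(1))
  have "s * s' \<in> {1, -1}" using IH(3) g(3) by auto
  then show ?case
    using g IH by (intro exI[of _ a''] exI[of _ b''] exI[of _ "s * s'"])
      (simp add: circuit_fun_append)
qed

section \<open>Restriction to the first k qubits\<close>

lemma low_bvecs_iff_drop:
  assumes "length v = n"
  shows "v \<in> low_bvecs n k \<longleftrightarrow> drop k v = replicate (n - k) False"
proof
  assume "v \<in> low_bvecs n k"
  then show "drop k v = replicate (n - k) False"
    using assms by (intro nth_equalityI) (auto simp: low_bvecs_def)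
next
  assume drop: "drop k v = replicate (n - k) False"
  have "\<not> v ! j" if "j < n" "k \<le> j" for j
  proof -
    have "drop k v ! (j - k) = v ! j" using that assms by simp
    then show ?thesis using that unfolding drop by simp
  qed
  then show "v \<in> low_bvecs n k" using assms by (auto simp: low_bvecs_def)
qed

text \<open>From position \<open>k\<close> on the bits of \<open>v\<close> are false and the factors
  are 1. Both the power of \<i> and the Z sign have this form.\<close>

lemma prod_low_bvecs:
  fixes h :: "nat \<Rightarrow> complex"
  assumes "v \<in> low_bvecs n k" "k \<le> n"
  shows "(\<Prod>j<n. if v ! j \<and> P j then h j else 1) =
    (\<Prod>j<k. if take k v ! j \<and> P j then h j else 1)"
proof -
  have "(\<Prod>j<n. if v ! j \<and> P j then h j else 1) = (\<Prod>j<k. if v ! j \<and> P j then h j else 1)"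
    using assms by (intro prod.mono_neutral_right) (auto simp: low_bvecs_def)
  then show ?thesis by simp
qed

text \<open>The bits of \<open>b\<close> from \<open>k\<close> on meet only zeros of
  \<open>a\<close> and \<open>v\<close>, so they influence neither the power of \<i> nor the
  sign.\<close>

lemma pauli_phase_take:
  assumes "a \<in> low_bvecs n k" "v \<in> low_bvecs n k" "length b = n" "k \<le> n"
  shows "pauli_phase (take k a) (take k b) (take k v) = pauli_phase a b v"
proof -
  have "length a = n" using assms by (simp add: low_bvecs_def)
  then have "\<i> ^ bit_dot (take k a) (take k b) = \<i> ^ bit_dot a b"
    using prod_low_bvecs[OF assms(1,4), of "(!) b" "\<lambda>_. \<i>"] assms(4)
    by (simp add: imaginary_power_bit_dot)
  moreover have "z_sign (take k b) (take k v) = z_sign b v"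
    using prod_low_bvecs[OF assms(2,4), of "(!) b" "\<lambda>_. -1"] assms(3,4)
    by (simp add: z_sign_def conj_commute)
  ultimately show ?thesis by (simp add: pauli_phase_def)
qed

lemma one_kron_zero_proj:
  assumes "k \<le> n"
  shows "1\<^sub>m (2 ^ k) \<otimes>\<^sub>K zero_proj (n - k) =
    monomial n (\<lambda>v. of_bool (v \<in> low_bvecs n k)) (\<lambda>v. v)"
  using assms unfolding one_mat_monomial zero_proj_monomial
  by (subst monomial_kron) (auto intro!: monomial_cong simp: low_bvecs_iff_drop)

lemma circuit_conj_projector:
  assumes "\<forall>g\<in>set gs. valid_gate n g"
  shows "circuit_mat n gs * monomial n (\<lambda>v. of_bool (v \<in> S)) (\<lambda>v. v) *
      mat_adjoint (circuit_mat n gs) =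
    monomial n (\<lambda>v. of_bool (circuit_fun (rev gs) v \<in> S)) (\<lambda>v. v)"
  unfolding mat_adjoint_circuit_mat[OF assms] unfolding circuit_mat_monomial[OF assms]
  using assms circuit_fun_rev[of "rev gs"]
  by (auto simp: monomial_mult intro!: monomial_cong)

text \<open>One direction verifies the constructed circuit; the other extracts, from an arbitrary
  diagonalizing circuit, how it acts on the orbit.\<close>

lemma diagonalizes_iff:
  assumes "\<forall>g\<in>set gs. valid_gate n g" "k \<le> n"
  shows "circuit_mat n gs * monomial n (\<lambda>v. of_bool (v \<in> S)) (\<lambda>v. v) *
      mat_adjoint (circuit_mat n gs) = 1\<^sub>m (2 ^ k) \<otimes>\<^sub>K zero_proj (n - k) \<longleftrightarrow>
    (\<forall>v. length v = n \<longrightarrow> (v \<in> S \<longleftrightarrow> circuit_fun gs v \<in> low_bvecs n k))" (is "?L \<longleftrightarrow> ?R")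
proof -
  have "?L \<longleftrightarrow> (\<forall>v. length v = n \<longrightarrow> (circuit_fun (rev gs) v \<in> S \<longleftrightarrow> v \<in> low_bvecs n k))"
    (is "_ \<longleftrightarrow> ?M")
  proof
    assume ?L
    then have eq: "monomial n (\<lambda>v. of_bool (circuit_fun (rev gs) v \<in> S)) (\<lambda>v. v) =
        monomial n (\<lambda>v. of_bool (v \<in> low_bvecs n k)) (\<lambda>v. v)"
      using assms by (simp add: circuit_conj_projector one_kron_zero_proj)
    show ?M
    proof (intro allI impI)
      fix v :: "bool list" assume "length v = n"
      from monomial_eqD[OF eq _ _ this]
      show "circuit_fun (rev gs) v \<in> S \<longleftrightarrow> v \<in> low_bvecs n k"
        by (auto simp: of_bool_def split: if_splits)
    qed
  next
    assume ?M
    then show ?L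
      using assms by (auto simp: circuit_conj_projector one_kron_zero_proj intro!: monomial_cong)
  qed
  \<comment> \<open>The circuit and its reverse are mutually inverse, so \<open>v\<close> may be
    replaced by its image under \<open>circuit_fun gs\<close>.\<close>
  also have "?M \<longleftrightarrow> ?R"
    using circuit_fun_rev[of gs] circuit_fun_rev[of "rev gs"] assms(1)
    by (metis length_circuit_fun rev_rev_ident set_rev)
  finally show ?thesis .
qed

text \<open>The Pauli string is conjugated by the circuit, shown to preserve the coordinate
  subspace, and then cut off after \<open>k\<close> positions. Only the condition that
  \<open>S\<close> corresponds to \<open>low_bvecs n k\<close> enters, not the way the circuit was
  built.\<close>

lemma restricted_pauli:
  assumes gs: "\<forall>g\<in>set gs. valid_gate n g" and k: "k \<le> n"
    and S: "\<And>v. length v = n \<Longrightarrow> v \<in> S \<longleftrightarrow> circuit_fun gs v \<in> low_bvecs n k"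
    and \<sigma>: "\<sigma> \<in> pauli_strings n"
    and P: "P = monomial n (\<lambda>v. of_bool (v \<in> S)) (\<lambda>v. v)"
    and comm: "\<sigma> * P = P * \<sigma>"
  shows "\<exists>\<tau>\<in>pauli_strings k. \<exists>s\<in>{1, -1}. \<sigma> * P =
    s \<cdot>\<^sub>m (mat_adjoint (circuit_mat n gs) * (\<tau> \<otimes>\<^sub>K zero_proj (n - k)) * circuit_mat n gs)"
proof -
  let ?f = "circuit_fun gs" and ?f' = "circuit_fun (rev gs)"
  obtain a b where ab: "\<sigma> = pauli a b" "length a = n" "length b = n"
    using \<sigma> by (auto simp: pauli_strings_eq)
  obtain a' b' s where conj: "length a' = n" "length b' = n" "s \<in> {1, -1}"
      "\<And>v. length v = n \<Longrightarrow> ?f (bxor a (?f' v)) = bxor a' v"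
      "\<And>v. length v = n \<Longrightarrow> pauli_phase a b (?f' v) = s * pauli_phase a' b' v"
    using circuit_conjugation[OF gs ab(2,3)] by blast
  have inv: "?f' (?f v) = v" "?f (?f' v) = v" if "length v = n" for v
    using circuit_fun_rev[of gs v] circuit_fun_rev[of "rev gs" v] gs that by auto
  have \<sigma>P: "\<sigma> * P = monomial n (\<lambda>v. pauli_phase a b v * of_bool (v \<in> S)) (bxor a)"
    and P\<sigma>: "P * \<sigma> = monomial n (\<lambda>v. of_bool (bxor a v \<in> S) * pauli_phase a b v) (bxor a)"
    using ab by (simp_all add: pauli_monomial P monomial_mult)
  \<comment> \<open>Phases never vanish, so equality of the two products compares the membership of
    \<open>v\<close> with that of its translate.\<close>
  have stable: "bxor a v \<in> S" if "v \<in> S" "length v = n" for v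
    using monomial_eqD[OF comm[unfolded \<sigma>P P\<sigma>], of v] that ab
    by (auto simp: pauli_phase_nonzero split: if_splits)
  have low_a': "a' \<in> low_bvecs n k"
  proof -
    \<comment> \<open>The conjugated translation sends the zero vector, which lies in the coordinate
      subspace, to \<open>a'\<close>.\<close>
    let ?z = "replicate n False"
    have "?z \<in> low_bvecs n k" by (simp add: low_bvecs_def)
    then have "?f' ?z \<in> S" by (simp add: S inv)
    then have "?f (bxor a (?f' ?z)) \<in> low_bvecs n k" using S stable ab by simp
    then show ?thesis using conj by (simp add: bxor_False)
  qed
  \<comment> \<open>The witness keeps the first \<open>k\<close> positions of the conjugated string;
    its sign is the \<open>s\<close> of the conjugation.\<close>
  define \<tau> where "\<tau> = pauli (take k a') (take k b')"
  have \<tau>: "\<tau> \<otimes>\<^sub>K zero_proj (n - k) =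
      monomial n (\<lambda>v. pauli_phase (take k a') (take k b') (take k v) * of_bool (v \<in> low_bvecs n k))
        (\<lambda>v. bxor (take k a') (take k v) @ drop k v)"
    using k conj unfolding \<tau>_def zero_proj_monomial
    by (subst pauli_monomial[where n = k]; simp)
      (subst monomial_kron; auto simp: low_bvecs_iff_drop intro!: monomial_cong)
  have rhs: "s \<cdot>\<^sub>m (mat_adjoint (circuit_mat n gs) * (\<tau> \<otimes>\<^sub>K zero_proj (n - k)) * circuit_mat n gs) =
      monomial n (\<lambda>v. s * (pauli_phase (take k a') (take k b') (take k (?f v)) *
          of_bool (?f v \<in> low_bvecs n k)))
        (\<lambda>v. ?f' (bxor (take k a') (take k (?f v)) @ drop k (?f v)))"
  proof -
    have maps: "(\<lambda>v. bxor (take k a') (take k v) @ drop k v) \<in> bvecs n \<rightarrow> bvecs n"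
      using k conj by auto
    then have "(\<lambda>v. ?f' (bxor (take k a') (take k v) @ drop k v)) \<in> bvecs n \<rightarrow> bvecs n"
      by auto
    then show ?thesis
      unfolding mat_adjoint_circuit_mat[OF gs] unfolding circuit_mat_monomial[OF gs] \<tau>
      using maps by (simp add: monomial_mult smult_monomial)
  qed
  have "\<sigma> * P = s \<cdot>\<^sub>m (mat_adjoint (circuit_mat n gs) * (\<tau> \<otimes>\<^sub>K zero_proj (n - k)) * circuit_mat n gs)"
    unfolding \<sigma>P rhs
  proof (rule monomial_cong)
    fix v :: "bool list" assume v: "length v = n"
    show "pauli_phase a b v * of_bool (v \<in> S) =
        s * (pauli_phase (take k a') (take k b') (take k (?f v)) * of_bool (?f v \<in> low_bvecs n k))"
      using v S[OF v] conj(2) conj(5)[of "?f v"] k low_a' inv(1)[OF v]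
      by (cases "v \<in> S") (simp_all add: pauli_phase_take)
    \<comment> \<open>The maps are compared only on columns in \<open>S\<close>. There
      \<open>a'\<close> and \<open>?f v\<close> vanish from position \<open>k\<close> on, so the
      truncated translation agrees with the full one.\<close>
    assume "pauli_phase a b v * of_bool (v \<in> S) \<noteq> 0"
    then have low: "?f v \<in> low_bvecs n k" using S[OF v] by (auto split: if_splits)
    have "drop k (bxor a' (?f v)) = drop k (?f v)"
      using low low_a' v conj(1)
      by (intro nth_equalityI) (auto simp: low_bvecs_def)
    moreover have "take k (bxor a' (?f v)) = bxor (take k a') (take k (?f v))"
      using v conj(1) by (intro nth_equalityI) auto
    ultimately have "bxor (take k a') (take k (?f v)) @ drop k (?f v) = bxor a' (?f v)"
      by (metis append_take_drop_id)
    then show "bxor a v = ?f' (bxor (take k a') (take k (?f v)) @ drop k (?f v))"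
      using conj(4)[of "?f v"] inv(1)[of "bxor a v"] inv(1)[OF v] v ab by simp
  qed (use k conj ab in auto)
  moreover have "\<tau> \<in> pauli_strings k"
    using conj k by (auto simp: \<tau>_def pauli_strings_eq intro!: exI)
  ultimately show ?thesis using conj(3) by blast
qed

text \<open>The constant is chosen before \<open>n\<close> and \<open>k\<close>, so the gate bound
  is uniform. The claim on Pauli strings covers every diagonalizing circuit of X and CX gates,
  whatever its length.\<close>

theorem theorem3:
  shows "\<exists>C::nat. \<forall>(n::nat) (k::nat) (Xs::complex mat list) (z::bool list).
    k \<ge> 1 \<longrightarrow> length Xs = k \<longrightarrow> minimal_X_generators n Xs \<longrightarrow> length z = n \<longrightarrow>
    (let P = orbit_proj n (X_orbit n Xs z);
         diagonalizes = (\<lambda>M. M * P * mat_adjoint M = 1\<^sub>m (2 ^ k) \<otimes>\<^sub>K zero_proj (n - k))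
     in
       (\<exists>gs. (\<forall>g\<in>set gs. valid_gate n g) \<and> length gs \<le> C * (n * k) \<and>
          permutation_operator n (circuit_mat n gs) \<and> diagonalizes (circuit_mat n gs)) \<and>
       (\<forall>gs. (\<forall>g\<in>set gs. valid_gate n g) \<and> diagonalizes (circuit_mat n gs) \<longrightarrow>
          (\<forall>\<sigma>\<in>pauli_strings n. \<sigma> * P = P * \<sigma> \<longrightarrow>
             (\<exists>\<tau>\<in>pauli_strings k. \<exists>s\<in>{1, -1}.
                \<sigma> * P = s \<cdot>\<^sub>m (mat_adjoint (circuit_mat n gs)
                  * (\<tau> \<otimes>\<^sub>K zero_proj (n - k)) * circuit_mat n gs)))))"
\<comment> \<open>The constant 2 pays once for the CX gates and once for the X gates.\<close>
proof (intro exI[of _ 2] allI impI)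
  fix n k :: nat and Xs :: "complex mat list" and z :: "bool list"
  assume k: "k \<ge> 1" "length Xs = k" and min: "minimal_X_generators n Xs" and z: "length z = n"
  obtain xs where xs: "Xs = map X_pow xs" "bindep n xs"
    using minimal_X_generatorsE[OF min] .
  then have len: "length xs = k" and sub: "set xs \<subseteq> bvecs n" using k by (auto simp: bindep_def)
  have "k \<le> n" using gaussian_elimination[OF xs(2)] len by simp
  define S where "S = bxor z ` bspan n (set xs)"
  have S: "S \<subseteq> bvecs n" using z length_bspan[OF _ sub] by (auto simp: S_def)
  have P: "orbit_proj n (X_orbit n Xs z) = monomial n (\<lambda>v. of_bool (v \<in> S)) (\<lambda>v. v)"
    unfolding xs(1) X_orbit_eq[OF sub z] S_def[symmetric] by (rule orbit_proj_monomial[OF S])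
  obtain gs where gs: "\<forall>g\<in>set gs. valid_gate n g" "length gs \<le> 2 * (n * k)"
      "circuit_fun gs ` S = low_bvecs n k"
    using bspan_translate_circuit[OF xs(2) z] k len unfolding S_def by auto
  \<comment> \<open>Injectivity of the circuit turns the equation of images into an equivalence for
    single vectors.\<close>
  have mem: "v \<in> S \<longleftrightarrow> circuit_fun gs v \<in> low_bvecs n k" if "length v = n" for v
    using inj_on_image_mem_iff[OF inj_on_circuit_fun[OF gs(1)], of v S] that S gs(3) by simp
  show "let P = orbit_proj n (X_orbit n Xs z);
         diagonalizes = (\<lambda>M. M * P * mat_adjoint M = 1\<^sub>m (2 ^ k) \<otimes>\<^sub>K zero_proj (n - k))
     in
       (\<exists>gs. (\<forall>g\<in>set gs. valid_gate n g) \<and> length gs \<le> 2 * (n * k) \<and>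
          permutation_operator n (circuit_mat n gs) \<and> diagonalizes (circuit_mat n gs)) \<and>
       (\<forall>gs. (\<forall>g\<in>set gs. valid_gate n g) \<and> diagonalizes (circuit_mat n gs) \<longrightarrow>
          (\<forall>\<sigma>\<in>pauli_strings n. \<sigma> * P = P * \<sigma> \<longrightarrow>
             (\<exists>\<tau>\<in>pauli_strings k. \<exists>s\<in>{1, -1}.
                \<sigma> * P = s \<cdot>\<^sub>m (mat_adjoint (circuit_mat n gs)
                  * (\<tau> \<otimes>\<^sub>K zero_proj (n - k)) * circuit_mat n gs))))"
    unfolding Let_def P
  proof (intro conjI allI impI ballI)
    show "\<exists>gs. (\<forall>g\<in>set gs. valid_gate n g) \<and> length gs \<le> 2 * (n * k) \<and>
        permutation_operator n (circuit_mat n gs) \<and>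
        circuit_mat n gs * monomial n (\<lambda>v. of_bool (v \<in> S)) (\<lambda>v. v) *
          mat_adjoint (circuit_mat n gs) = 1\<^sub>m (2 ^ k) \<otimes>\<^sub>K zero_proj (n - k)"
      using gs(1,2) permutation_operator_circuit[OF gs(1)] diagonalizes_iff[OF gs(1) \<open>k \<le> n\<close>] mem
      by blast
  next
    fix hs \<sigma>
    assume hs: "(\<forall>g\<in>set hs. valid_gate n g) \<and>
        circuit_mat n hs * monomial n (\<lambda>v. of_bool (v \<in> S)) (\<lambda>v. v) *
          mat_adjoint (circuit_mat n hs) = 1\<^sub>m (2 ^ k) \<otimes>\<^sub>K zero_proj (n - k)"
      and \<sigma>: "\<sigma> \<in> pauli_strings n"
        "\<sigma> * monomial n (\<lambda>v. of_bool (v \<in> S)) (\<lambda>v. v) =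
          monomial n (\<lambda>v. of_bool (v \<in> S)) (\<lambda>v. v) * \<sigma>"
    show "\<exists>\<tau>\<in>pauli_strings k. \<exists>s\<in>{1, -1}. \<sigma> * monomial n (\<lambda>v. of_bool (v \<in> S)) (\<lambda>v. v) =
        s \<cdot>\<^sub>m (mat_adjoint (circuit_mat n hs) * (\<tau> \<otimes>\<^sub>K zero_proj (n - k)) * circuit_mat n hs)"
      using diagonalizes_iff[of hs n k S] hs \<open>k \<le> n\<close> \<sigma> by (intro restricted_pauli) auto
  qed
qed

end
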